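(* Let $A,E\in\mathbb{R}^{n,n}$ with $A$ having no eigenvalues on $\mathbb{R}^-=(-\infty,0]$, and let $h>0$ be a real parameter. 1. Consider the complex iteration $\widehat{X}_{k+1}=\tfrac{1}{2}\left(\widehat{X}_k+\widehat{X}_k^{-1}\widehat{X}_0\right)$, $\widehat{X}_0=A+ihE$. Then for all sufficiently small $h$ all iterates $\widehat{X}_k\in\mathbb{C}^{n,n}$ are nonsingular, and (i) $\lim_{k\to\infty}\mathrm{Re}(\widehat{X}_k)=A^{1/2}+\mathcal{O}(h^2)$, (ii) $\lim_{k\to\infty}\mathrm{Im}(\widehat{X}_k/h)=L_{X^{1/2}}(A,E)+\mathcal{O}(h^2)$. 2. Consider the complex iteration $$\widehat{Y}_{k+1}=\tfrac12\left(\widehat{Y}_k+\widehat{Z}_k^{-1}\right),\ \widehat{Y}_0=A+ihE,\qquad \widehat{Z}_{k+1}=\tfrac12\left(\widehat{Z}_k+\widehat{Y}_k^{-1}\right),\ \widehat{Z}_0=I_n.$$ Then for all sufficiently small $h$ all iterates $\widehat{Y}_k,\widehat{Z}_k\in\mathbb{C}^{n,n}$ are nonsingular, and (i) $\lim_{k\to\infty}\mathrm{Re}(\widehat{Y}_k)=A^{1/2}+\mathcal{O}(h^2)$, (ii) $\lim_{k\to\infty}\mathrm{Re}(\widehat{Z}_k)=A^{-1/2}+\mathcal{O}(h^2)$, (iii) $\lim_{k\to\infty}\mathrm{Im}(\widehat{Y}_k/h)=L_{X^{1/2}}(A,E)+\mathcal{O}(h^2)$, (iv) $\lim_{k\to\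infty}\mathrm{Im}(\widehat{Z}_k/h)=L_{X^{-1/2}}(A,E)+\mathcal{O}(h^2)$.
   Context: $A^{1/2}$ denotes the principal square root of $A$ (the unique square root with all eigenvalues in the open right half-plane), and $A^{-1/2}=(A^{1/2})^{-1}$. $L_{X^{1/2}}(A,E)$ and $L_{X^{-1/2}}(A,E)$ denote the Fréchet derivatives of $X\mapsto X^{1/2}$ and $X\mapsto X^{-1/2}$ at $A$ in direction $E$. $\mathrm{Re}$, $\mathrm{Im}$ are taken entrywise. A matrix-valued quantity $Q(h)$ satisfies $Q(h)=B+\mathcal{O}(h^2)$ if there is a constant $C$ with $\|Q(h)-B\|_F\le Ch^2$ as $h\to 0$. *)

theory Defs
  imports "HOL-Analysis.Analysis"
begin

text \<open>Matrices are type-indexed: real^'n^'n and complex^'n^'n. The norm on these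
  types is the Euclidean norm of all entries, i.e. the Frobenius norm.\<close>

definition cmat :: "real^'n^'n \<Rightarrow> complex^'n^'n" where
  "cmat A = (\<chi> i j. complex_of_real (A $ i $ j))"

definition mRe :: "complex^'n^'n \<Rightarrow> real^'n^'n" where
  "mRe M = (\<chi> i j. Re (M $ i $ j))"

definition mIm :: "complex^'n^'n \<Rightarrow> real^'n^'n" where
  "mIm M = (\<chi> i j. Im (M $ i $ j))"

definition ceigenvalue :: "complex^'n^'n \<Rightarrow> complex \<Rightarrow> bool" where
  "ceigenvalue M z \<longleftrightarrow> (\<exists>v. v \<noteq> 0 \<and> M *v v = z *s v)"

definition msqrt :: "real^'n^'n \<Rightarrow> real^'n^'n" where
  "msqrt A = (THE X. X ** X = A \<and> (\<forall>z. ceigenvalue (cmat X) z \<longrightarrow> Re z > 0))"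

definition minvsqrt :: "real^'n^'n \<Rightarrow> real^'n^'n" where
  "minvsqrt A = matrix_inv (msqrt A)"

primrec newton_iter :: "complex^'n^'n \<Rightarrow> nat \<Rightarrow> complex^'n^'n" where
  "newton_iter X0 0 = X0"
| "newton_iter X0 (Suc k) =
     (1/2) *\<^sub>R (newton_iter X0 k + matrix_inv (newton_iter X0 k) ** X0)"

primrec db_iter :: "complex^'n^'n \<Rightarrow> nat \<Rightarrow> (complex^'n^'n) \<times> (complex^'n^'n)" where
  "db_iter Y0 0 = (Y0, mat 1)"
| "db_iter Y0 (Suc k) =
     (let Y = fst (db_iter Y0 k); Z = snd (db_iter Y0 k) in
       ((1/2) *\<^sub>R (Y + matrix_inv Z), (1/2) *\<^sub>R (Z + matrix_inv Y)))"

end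

(* If S is the principal square root of M, the Newton iterates satisfy
   X_k (1 - B^(2^k)) = S (1 + B^(2^k)) with B = (S - 1) (S + 1)^-1, and B has spectral radius below
   one because the spectrum of S lies in the right half-plane; the second iteration is
   (X_k, M^-1 X_k). So everything reduces to the principal square root S_h = P + iQ of A + ihE.
   It exists and tends to R = A^(1/2), since squaring is a local homeomorphism at R: its derivative,
   the Sylvester operator D |-> R D + D R, is injective. Comparing real and imaginary parts in
   P^2 - Q^2 = A and P Q + Q P = h E gives first Q = O(h), then P - R = O(h^2), and finally
   Q = h L + O(h^3), where R L + L R = E. The inverse of S_h is treated in the same way. *)
theory Submission
  imports Defs "HOL-Computational_Algebra.Fundamental_Theorem_Algebra"
begin

text \<open>The spectral arguments work without normal forms. Their common tool is a list
  \<open>ls\<close> of eigenvalues, repetitions allowed, for which the product of the factors M - z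
  vanishes (\<open>ex_eigenvalue_list\<close>). Claims about vectors are proved by induction along
  the list: passing from v to (M - z) v removes one factor and leaves a single linear step whose
  remainder is already under control. This yields injectivity of D |-> X D + D Y for spectra in the
  right half-plane, existence of the root as a polynomial in M, and decay of the powers of B. The
  injectivity serves three purposes: uniqueness of the root (applied to the difference of two
  roots), existence of roots nearby, and, through the inverse operator G, the derivative of the
  square root. The perturbed root comes from an open mapping argument at R rather than from the
  spectrum of A + ihE. The imaginary part is needed up to O(h^3) because it is divided by h
  afterwards.\<close>

lemma bounded_bilinear_matrix_mult:
  "bounded_bilinear ((**) :: 'a::{euclidean_space,real_algebra_1}^'n^'n \<Rightarrow> 'a^'n^'n \<Rightarrow> 'a^'n^'n)"
  by (subst bilinear_conv_bounded_bilinear [symmetric])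
     (auto simp: bilinear_def matrix_matrix_mult_def vec_eq_iff algebra_simps sum.distrib
        scaleR_sum_right intro!: linearI)

lemma bounded_bilinear_matrix_vector_mult:
  "bounded_bilinear ((*v) :: 'a::{euclidean_space,real_algebra_1}^'n^'n \<Rightarrow> 'a^'n \<Rightarrow> 'a^'n)"
  by (subst bilinear_conv_bounded_bilinear [symmetric])
     (auto simp: bilinear_def matrix_vector_mult_def vec_eq_iff algebra_simps sum.distrib
        scaleR_sum_right intro!: linearI)

interpretation mm: bounded_bilinear
  "(**) :: 'a::{euclidean_space,real_algebra_1}^'n^'n \<Rightarrow> 'a^'n^'n \<Rightarrow> 'a^'n^'n"
  by (rule bounded_bilinear_matrix_mult)

interpretation mv: bounded_bilinear
  "(*v) :: 'a::{euclidean_space,real_algebra_1}^'n^'n \<Rightarrow> 'a^'n \<Rightarrow> 'a^'n"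
  by (rule bounded_bilinear_matrix_vector_mult)

lemmas mm_distribs = mm.add_left mm.add_right mm.diff_left mm.diff_right

section \<open>Scalar matrices\<close>

lemma mat_mult_vec: "mat c *v v = c *s (v :: 'a::semiring_1^'n)"
  by (simp add: vec_eq_iff matrix_vector_mult_def mat_def if_distrib if_distribR sum.If_cases
      cong: if_cong)

lemma mat_commute: "mat c ** M = M ** mat (c :: 'a::comm_semiring_1)"
  by (simp add: vec_eq_iff matrix_matrix_mult_def mat_def if_distrib if_distribR sum.If_cases
      mult.commute cong: if_cong)

lemma mat_add: "mat (a + b) = mat a + (mat b :: 'a::semiring_1^'n^'n)"
  by (simp add: vec_eq_iff mat_def)

lemma mat_mult: "mat (a * b) = mat a ** (mat b :: 'a::field^'n^'n)"
  by (simp add: matrix_eq mat_mult_vec vec.scale_scale flip: matrix_vector_mul_assoc)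

lemma mat_uminus: "mat (- a) = - (mat a :: 'a::ring_1^'n^'n)"
  by (simp add: vec_eq_iff mat_def)

lemma mat_of_real: "mat (complex_of_real r) = r *\<^sub>R mat 1"
  by (simp add: vec_eq_iff mat_def) (simp add: of_real_def)

subsection \<open>Polynomials of matrices\<close>

text \<open>The Horner scheme, so that \<open>mpoly_pCons\<close> supports induction on polynomials.
  Complex scalars act through the scalar matrices \<open>mat a\<close>, since
  \<open>*\<^sub>R\<close> takes real scalars only.\<close>

definition mpoly :: "complex poly \<Rightarrow> complex^'n^'n \<Rightarrow> complex^'n^'n" where
  "mpoly p M = fold_coeffs (\<lambda>a B. mat a + M ** B) p 0"

lemma mpoly_0 [simp]: "mpoly 0 M = 0"
  by (simp add: mpoly_def)

lemma mpoly_pCons [simp]: "mpoly (pCons a p) M = mat a + M ** mpoly p M"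
  by (cases "p = 0 \<and> a = 0") (auto simp: mpoly_def)

lemma mpoly_1 [simp]: "mpoly 1 M = mat 1"
  unfolding one_pCons by simp

lemma mpoly_add: "mpoly (p + q) M = mpoly p M + mpoly q M"
  by (induction p q rule: poly_induct2) (simp_all add: mat_add mm.add_right)

lemma mpoly_smult: "mpoly (smult a p) M = mat a ** mpoly p M"
  by (induction p)
     (simp_all add: mat_mult mm.add_right matrix_mul_assoc mat_commute[of a M])

lemma mpoly_mult: "mpoly (p * q) M = mpoly p M ** mpoly q M"
  by (induction p)
     (simp_all add: mpoly_add mpoly_smult mm.add_left matrix_mul_assoc)

lemma mpoly_diff: "mpoly (p - q) M = mpoly p M - mpoly q M"
  using mpoly_add[of "p - q" q M] by simp

lemma mpoly_sum: "mpoly (sum f A) M = (\<Sum>i\<in>A. mpoly (f i) M)"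
  by (induction A rule: infinite_finite_induct) (simp_all add: mpoly_add)

lemma mpoly_commute: "mpoly p M ** mpoly q M = mpoly q M ** mpoly p M"
  by (simp flip: mpoly_mult add: mult.commute)

lemma mpoly_eigenvector: 
  assumes "M *v v = z *s v" shows "mpoly p M *v v = poly p z *s v"
proof (induction p)
  case (pCons a p)
  have "M *v (poly p z *s v) = poly p z *s (M *v v)"
    by (simp add: vec.scale)
  then show ?case
    by (simp add: mv.add_left mat_mult_vec pCons assms vec.scale_left_distrib mult.commute
        flip: matrix_vector_mul_assoc)
qed auto

text \<open>Dimension count over the reals: one power of M more than the real dimension of the
  matrix space forces a linear relation. The degree bound of Cayley-Hamilton is not aimed
  at.\<close>

lemma ex_annihilating_poly: "\<exists>p. p \<noteq> 0 \<and> mpoly p M = 0" for M :: "complex^'n^'n"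
proof -
  define f where "f i = mpoly (monom 1 i) M" for i
  let ?N = "DIM(complex^'n^'n)"
  show ?thesis
  \<comment> \<open>Linear dependence concerns the set of powers, in which repetitions collapse. If
    two powers coincide, the difference of their monomials annihilates M directly.\<close>
  proof (cases "inj_on f {..?N}")
    case True
    then have "card (f ` {..?N}) > ?N" by (simp add: card_image)
    then have "dependent (f ` {..?N})" by (intro dependent_biggerset) auto
    then obtain u where u: "\<exists>v\<in>f ` {..?N}. u v \<noteq> 0" "(\<Sum>v\<in>f ` {..?N}. u v *\<^sub>R v) = 0"
      by (auto simp: dependent_finite)
    define p :: "complex poly" where "p = (\<Sum>i\<le>?N. smult (of_real (u (f i))) (monom 1 i))"
    have "mpoly p M = (\<Sum>i\<le>?N. u (f i) *\<^sub>R f i)"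
      by (simp add: p_def mpoly_sum mpoly_smult f_def mat_of_real mm.scaleR_left del: smult_monom)
    also have "\<dots> = 0"
      using u(2) unfolding sum.reindex[OF True] by (simp add: o_def)
    finally have "mpoly p M = 0" .
    moreover obtain k where k: "k \<le> ?N" "u (f k) \<noteq> 0" using u(1) by auto
    have "coeff p k = (\<Sum>i\<le>?N. if i = k then of_real (u (f i)) else 0)"
      unfolding p_def by (simp add: coeff_sum coeff_monom if_distrib cong: if_cong)
    then have "coeff p k \<noteq> 0" using k by simp
    then have "p \<noteq> 0" by auto
    ultimately show ?thesis by blast
  next
    case False
    then obtain i j where "i \<noteq> j" "f i = f j" by (auto simp: inj_on_def)
    then have "mpoly (monom 1 i - monom 1 j) M = 0" by (simp add: mpoly_diff f_def)
    moreover have "coeff (monom 1 i - monom 1 j) i \<noteq> (0::complex)"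
      using \<open>i \<noteq> j\<close> by (simp add: coeff_monom)
    then have "monom 1 i - monom 1 j \<noteq> (0::complex poly)" by force
    ultimately show ?thesis by blast
  qed
qed

section \<open>Annihilating products of linear factors\<close>

definition fac :: "complex list \<Rightarrow> complex poly" where
  "fac ls = (\<Prod>x\<leftarrow>ls. [:- x, 1:])"

lemma fac_simps [simp]: "fac [] = 1" "fac (x # ls) = [:- x, 1:] * fac ls"
  by (simp_all add: fac_def)

text \<open>The head factor is moved to the right end, where it acts on the vector first. This turns
  a hypothesis on v for \<open>x # ls\<close> into one on (M - x) v for \<open>ls\<close>, the form
  that the inductions along the list use.\<close>

lemma mpoly_fac_Cons: "mpoly (fac (x # ls)) M *v v = mpoly (fac ls) M *v (M *v v - x *s v)"
proof -
  have "mpoly (fac (x # ls)) M = mpoly (fac ls) M ** (M - mat x)"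
    unfolding fac_simps mult.commute[of _ "fac ls"] by (simp only: mpoly_mult, simp add: mat_uminus)
  then show ?thesis
    by (simp add: mv.diff_left mat_mult_vec flip: matrix_vector_mul_assoc)
qed

lemma not_eigenvalueD: "\<not> ceigenvalue M z \<Longrightarrow> M *v v = z *s v \<Longrightarrow> v = 0"
  by (auto simp: ceigenvalue_def)

lemma invertibleI_ker:
  fixes M :: "'a::field^'n^'n"
  assumes "\<And>v. M *v v = 0 \<Longrightarrow> v = 0" shows "invertible M"
  using assms matrix_left_invertible_ker matrix_left_right_inverse unfolding invertible_def by metis

text \<open>M - x is injective when x is not an eigenvalue, and it commutes with the other factors,
  so it can be cancelled.\<close>

lemma mpoly_fac_eigenvalues:
  "mpoly (fac ls) M *v v = 0 \<Longrightarrow> mpoly (fac (filter (ceigenvalue M) ls)) M *v v = 0"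
proof (induction ls arbitrary: v)
  case (Cons x ls)
  let ?w = "M *v v - x *s v"
  have *: "mpoly (fac (filter (ceigenvalue M) ls)) M *v ?w = 0"
    using Cons by (simp add: mpoly_fac_Cons del: fac_simps)
  show ?case
  proof (cases "ceigenvalue M x")
    case True
    then show ?thesis using * by (simp add: mpoly_fac_Cons del: fac_simps)
  next
    case False
    let ?F = "mpoly (fac (filter (ceigenvalue M) ls)) M"
    have "mpoly [:-x, 1:] M *v (?F *v v) = ?F *v (mpoly [:-x, 1:] M *v v)"
      unfolding matrix_vector_mul_assoc by (subst mpoly_commute) simp
    also have "mpoly [:-x, 1:] M *v v = ?w" by (simp add: mv.add_left mv.diff_left mat_mult_vec mat_uminus mv.minus_left)
    finally have "M *v (?F *v v) = x *s (?F *v v)"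
      using * by (simp add: mv.add_left mv.diff_left mat_mult_vec mat_uminus mv.minus_left)
    then have "?F *v v = 0" using False by (blast dest: not_eigenvalueD)
    then show ?thesis using False by simp
  qed
qed auto

text \<open>An annihilating polynomial splits over the complex numbers; its nonzero leading
  coefficient is divided off and the factors at non-eigenvalues are cancelled.\<close>

lemma ex_eigenvalue_list:
  fixes M :: "complex^'n^'n"
  shows "\<exists>ls. (\<forall>z\<in>set ls. ceigenvalue M z) \<and> mpoly (fac ls) M = 0"
proof -
  obtain p where p: "p \<noteq> 0" "mpoly p M = 0" using ex_annihilating_poly by blast
  obtain A where A: "p = smult (lead_coeff p) (\<Prod>x\<in>#A. [:-x, 1:])"
    using alg_closed_imp_factorization[OF p(1)] by blast
  obtain ls where ls: "mset ls = A" using ex_mset by blast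
  have "(\<Prod>x\<in>#A. [:-x, 1:]) = fac ls"
    unfolding ls[symmetric] fac_def by (metis mset_map prod_mset_prod_list)
  then have "mat (lead_coeff p) ** mpoly (fac ls) M = 0"
    using A p(2) by (metis mpoly_smult)
  then have "mat (1 / lead_coeff p) ** (mat (lead_coeff p) ** mpoly (fac ls) M) = 0" by simp
  then have "mpoly (fac ls) M = 0"
    using p(1) by (simp add: matrix_mul_assoc flip: mat_mult)
  then have "mpoly (fac (filter (ceigenvalue M) ls)) M *v v = 0" for v
    by (simp add: mpoly_fac_eigenvalues)
  then show ?thesis
    by (intro exI[of _ "filter (ceigenvalue M) ls"]) (auto simp: matrix_eq)
qed

subsection \<open>The principal square root\<close>

definition rhp :: "complex^'n^'n \<Rightarrow> bool" where
  "rhp X \<longleftrightarrow> (\<forall>z. ceigenvalue X z \<longrightarrow> Re z > 0)"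

text \<open>If Y v = z v, then X (D v) = - z (D v), and - z lies in the left half-plane, so D v = 0.
  For general v, the induction hypothesis says that D kills (Y - z) v, that is D (Y v) = z (D v),
  and the same argument applies.\<close>

lemma sylvester_injective:
  fixes X Y D :: "complex^'n^'n"
  assumes X: "rhp X" and Y: "rhp Y" and eq: "X ** D + D ** Y = 0"
  shows "D = 0"
proof -
  obtain ls where ls: "\<forall>z\<in>set ls. ceigenvalue Y z" "mpoly (fac ls) Y = 0"
    using ex_eigenvalue_list by blast
  have "\<forall>z\<in>set ls. Re z > 0" using ls(1) Y by (auto simp: rhp_def)
  then have *: "D *v v = 0" if "mpoly (fac ls) Y *v v = 0" for v
    using that
  proof (induction ls arbitrary: v)
    case (Cons z ls)
    then have "D *v (Y *v v - z *s v) = 0" by (simp add: mpoly_fac_Cons del: fac_simps)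
    then have "D *v (Y *v v) = z *s (D *v v)"
      by (simp add: mv.diff_right vec.scale)
    moreover have "X *v (D *v v) + D *v (Y *v v) = 0"
      using arg_cong[OF eq, of "\<lambda>B. B *v v"] by (simp add: mv.add_left matrix_vector_mul_assoc)
    ultimately have "X *v (D *v v) = (- z) *s (D *v v)"
      by (simp add: add_eq_0_iff2)
    moreover have "\<not> ceigenvalue X (- z)" using X Cons.prems(1) unfolding rhp_def by force
    ultimately show ?case by (blast dest: not_eigenvalueD)
  qed simp
  show ?thesis unfolding matrix_eq using * ls(2) by simp
qed

text \<open>The difference of the two roots solves a homogeneous Sylvester equation with coefficient
  X on the left and Y on the right.\<close>

lemma rhp_sqrt_unique:
  assumes "rhp X" "rhp Y" "X ** X = Y ** Y" shows "X = Y"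
proof -
  have "X ** (X - Y) + (X - Y) ** Y = 0" using assms(3) by (simp add: mm_distribs)
  then have "X - Y = 0" by (rule sylvester_injective[OF assms(1,2)])
  then show ?thesis by simp
qed

text \<open>Since S commutes with M, each factor M - z maps the eigenspace of S for m to itself.
  Going down the list, the last nonzero vector before the product vanishes is an eigenvector of
  both. It locates the eigenvalues of a polynomial in M.\<close>

lemma ex_common_eigenvector:
  assumes "mpoly (fac ls) M *v v = 0" "v \<noteq> 0" "S *v v = m *s v" "S ** M = M ** S"
  shows "\<exists>z\<in>set ls. \<exists>w. w \<noteq> 0 \<and> M *v w = z *s w \<and> S *v w = m *s w"
  using assms
proof (induction ls arbitrary: v)
  case (Cons z ls)
  let ?w = "M *v v - z *s v"
  show ?case
  proof (cases "?w = 0")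
    case True
    then show ?thesis using Cons.prems by auto
  next
    case False
    have "S *v (M *v v) = M *v (S *v v)"
      by (simp add: matrix_vector_mul_assoc Cons.prems(4))
    then have "S *v ?w = m *s ?w"
      by (simp add: mv.diff_right vec.scale Cons.prems(3) vec.scale_right_diff_distrib
          vec.scale_scale mult.commute)
    then show ?thesis
      using Cons.IH[OF _ False _ Cons.prems(4)] Cons.prems(1)
      by (auto simp: mpoly_fac_Cons simp del: fac_simps)
  qed
qed auto

text \<open>Newton interpolation: a linear factor of the modulus is added at a time, with the
  correction chosen so that the value at the new node is the prescribed square root.\<close>

lemma ex_sqrt_poly_mod_fac:
  assumes "0 \<notin> set ls"
  shows "\<exists>q. fac ls dvd q\<^sup>2 - [:0, 1:] \<and> (\<forall>z\<in>set ls. poly q z = csqrt z)"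
  using assms
proof (induction ls)
  case (Cons z ls)
  then obtain q where q: "fac ls dvd q\<^sup>2 - [:0, 1:]" "\<forall>z\<in>set ls. poly q z = csqrt z" by auto
  then obtain r where r: "q\<^sup>2 - [:0, 1:] = fac ls * r" by blast
  have z: "z \<noteq> 0" using Cons.prems by auto
  have fac0: "poly (fac ls) w = 0 \<longleftrightarrow> w \<in> set ls" for w
    by (induction ls) auto
  have upd: "(q + smult c (fac ls))\<^sup>2 - [:0, 1:] = fac ls * (r + smult (2 * c) q + smult (c\<^sup>2) (fac ls))" for c
  proof -
    have "(poly q x)\<^sup>2 - x = poly (fac ls) x * poly r x" for x
      using arg_cong[OF r, of "\<lambda>p. poly p x"] by simp
    then have "(poly q x + c * poly (fac ls) x)\<^sup>2 - x
        = poly (fac ls) x * (poly r x + 2 * c * poly q x + c\<^sup>2 * poly (fac ls) x)" for x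
      by (simp add: algebra_simps power2_eq_square)
    then show ?thesis
      by (simp add: poly_eq_poly_eq_iff[symmetric] fun_eq_iff)
  qed
  \<comment> \<open>At a new node, c interpolates the value \<open>csqrt z\<close>. At a repeated
    node the value is already right and c acts as a Hensel lift: the cofactor at z becomes r(z) + 2
    c \<open>csqrt z\<close>, which c makes zero. The division is legitimate because z is
    nonzero.\<close>
  define c where "c = (if z \<in> set ls then - poly r z / (2 * csqrt z)
     else (csqrt z - poly q z) / poly (fac ls) z)"
  let ?q = "q + smult c (fac ls)"
  have qz: "poly ?q z = csqrt z"
    using q(2) fac0[of z] by (auto simp: c_def)
  have "poly (r + smult (2 * c) q + smult (c\<^sup>2) (fac ls)) z = 0"
  proof (cases "z \<in> set ls")
    case True
    then show ?thesis using z q(2) fac0[of z] by (simp add: c_def)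
  next
    case False
    have "poly (?q\<^sup>2 - [:0, 1:]) z = 0"
      using qz by (simp add: del: poly_add)
    then show ?thesis unfolding upd using False fac0[of z] by simp
  qed
  then have "[:- z, 1:] dvd r + smult (2 * c) q + smult (c\<^sup>2) (fac ls)"
    by (simp only: poly_eq_0_iff_dvd)
  then have "fac (z # ls) dvd ?q\<^sup>2 - [:0, 1:]"
    unfolding upd by (simp only: fac_simps mult.commute[of "[:- z, 1:]"] mult_dvd_mono dvd_refl)
  moreover have "\<forall>w\<in>set (z # ls). poly ?q w = csqrt w"
    using q(2) qz fac0 by auto
  ultimately show ?case by blast
qed (auto intro: exI[of _ 1])

lemma Re_csqrt_pos: 
  assumes "\<not> (Im z = 0 \<and> Re z \<le> 0)" shows "Re (csqrt z) > 0"
proof (rule ccontr)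
  assume "\<not> Re (csqrt z) > 0"
  then have "Re (csqrt z) = 0" using csqrt_principal[of z] by auto
  then have "(csqrt z)\<^sup>2 = - of_real ((Im (csqrt z))\<^sup>2)"
    by (simp add: complex_eq_iff power2_eq_square)
  then have "z = - of_real ((Im (csqrt z))\<^sup>2)" by simp
  then have "Im z = 0 \<and> Re z \<le> 0" 
    by (metis Im_complex_of_real Re_complex_of_real minus_complex.simps neg_0_equal_iff_equal
        neg_le_0_iff_le uminus_complex.simps zero_le_power2)
  then show False using assms by simp
qed

text \<open>The root is q(M) for the interpolating q: a congruence modulo the annihilating
  \<open>fac ls\<close> becomes an equation of matrices. An eigenvalue of q(M) has an eigenvector
  shared with M, hence is \<open>csqrt z\<close> for an eigenvalue z of M off the closed negative
  axis.\<close>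

lemma ex_rhp_sqrt:
  fixes M :: "complex^'n^'n"
  assumes "\<And>z. Im z = 0 \<Longrightarrow> Re z \<le> 0 \<Longrightarrow> \<not> ceigenvalue M z"
  shows "\<exists>X. X ** X = M \<and> rhp X"
proof -
  obtain ls where ls: "\<forall>z\<in>set ls. ceigenvalue M z" "mpoly (fac ls) M = 0"
    using ex_eigenvalue_list by blast
  have "0 \<notin> set ls" using ls(1) assms[of 0] by auto
  then obtain q where q: "fac ls dvd q\<^sup>2 - [:0, 1:]" "\<forall>z\<in>set ls. poly q z = csqrt z"
    using ex_sqrt_poly_mod_fac by blast
  let ?X = "mpoly q M"
  have "mpoly (q\<^sup>2 - [:0, 1:]) M = 0" using q(1) ls(2) by (auto simp: mpoly_mult elim!: dvdE)
  then have "?X ** ?X = M" by (simp add: mpoly_diff power2_eq_square mpoly_mult)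
  moreover have "Re m > 0" if m: "ceigenvalue ?X m" for m
  proof -
    obtain v where v: "v \<noteq> 0" "?X *v v = m *s v" using m by (auto simp: ceigenvalue_def)
    have "?X ** M = M ** ?X" using mpoly_commute[of q M "[:0,1:]"] by simp
    then obtain z w where w: "z \<in> set ls" "w \<noteq> 0" "M *v w = z *s w" "?X *v w = m *s w"
      using ex_common_eigenvector[of ls M v ?X m] v ls(2) by auto
    then have "m *s w = csqrt z *s w" using mpoly_eigenvector[of M w z q] q(2) by simp
    then have "m = csqrt z" using w(2) by simp
    then show ?thesis using ls(1) w(1) assms[of z] Re_csqrt_pos by blast
  qed
  ultimately show ?thesis unfolding rhp_def by blast
qed

subsection \<open>Real and imaginary parts\<close>

definition mcnj :: "complex^'n^'n \<Rightarrow> complex^'n^'n" where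
  "mcnj X = (\<chi> i j. cnj (X $ i $ j))"

lemma mcnj_mult: "mcnj (X ** Y) = mcnj X ** mcnj Y"
  by (simp add: mcnj_def matrix_matrix_mult_def vec_eq_iff cnj_sum)

lemma mcnj_cmat [simp]: "mcnj (cmat A) = cmat A"
  by (simp add: mcnj_def cmat_def)

lemma ceigenvalue_mcnj: assumes "ceigenvalue (mcnj X) z" shows "ceigenvalue X (cnj z)"
proof -
  obtain v where v: "v \<noteq> 0" "mcnj X *v v = z *s v" using assms by (auto simp: ceigenvalue_def)
  let ?w = "\<chi> i. cnj (v $ i)"
  have "(X *v ?w) $ i = cnj ((mcnj X *v v) $ i)" for i
    by (simp add: matrix_vector_mult_def mcnj_def cnj_sum)
  then have "X *v ?w = cnj z *s ?w" unfolding v(2) by (simp add: vec_eq_iff)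
  moreover have "?w \<noteq> 0" using v(1) by (simp add: vec_eq_iff)
  ultimately show ?thesis by (auto simp: ceigenvalue_def)
qed

lemma rhp_mcnj: "rhp X \<Longrightarrow> rhp (mcnj X)"
  using ceigenvalue_mcnj by (fastforce simp: rhp_def)

lemma mRe_cmat [simp]: "mRe (cmat A) = A"
  by (simp add: mRe_def cmat_def)

lemma mIm_cmat [simp]: "mIm (cmat A) = 0"
  by (simp add: mIm_def cmat_def vec_eq_iff)

lemma mRe_mat_1 [simp]: "mRe (mat 1) = mat 1"
  by (simp add: mRe_def mat_def vec_eq_iff)

lemma mIm_mat_1 [simp]: "mIm (mat 1) = 0"
  by (simp add: mIm_def mat_def vec_eq_iff)

lemma cmat_mult: "cmat (A ** B) = cmat A ** cmat B"
  by (simp add: cmat_def matrix_matrix_mult_def vec_eq_iff)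

lemma cmat_mat_1 [simp]: "cmat (mat 1) = mat 1"
  by (simp add: cmat_def mat_def vec_eq_iff)

lemma mRe_mult: "mRe (X ** Y) = mRe X ** mRe Y - mIm X ** mIm Y"
  by (simp add: mRe_def mIm_def matrix_matrix_mult_def vec_eq_iff sum_subtractf)

lemma mIm_mult: "mIm (X ** Y) = mRe X ** mIm Y + mIm X ** mRe Y"
  by (simp add: mRe_def mIm_def matrix_matrix_mult_def vec_eq_iff sum.distrib)

lemma bounded_linear_mRe: "bounded_linear mRe"
  by (intro linear_conv_bounded_linear[THEN iffD1] linearI) (simp_all add: mRe_def vec_eq_iff)

lemma bounded_linear_mIm: "bounded_linear mIm"
  by (intro linear_conv_bounded_linear[THEN iffD1] linearI) (simp_all add: mIm_def vec_eq_iff)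

lemma bounded_linear_cmat: "bounded_linear cmat"
  by (intro linear_conv_bounded_linear[THEN iffD1] linearI)
     (simp_all add: cmat_def vec_eq_iff complex_eq_iff)


text \<open>The entrywise conjugate of X is again a root of the same real matrix with spectrum in
  the right half-plane; uniqueness makes X real.\<close>

lemma rhp_sqrt_real:
  assumes "rhp X" "X ** X = cmat R" shows "cmat (mRe X) = X"
proof -
  have "mcnj X ** mcnj X = X ** X" by (simp add: assms(2) flip: mcnj_mult)
  then have "mcnj X = X" using rhp_sqrt_unique rhp_mcnj assms(1) by blast
  then show ?thesis
    by (simp add: mcnj_def cmat_def mRe_def vec_eq_iff complex_eq_iff)
qed

text \<open>Connects the definite description over real matrices with complex roots; uniqueness is
  inherited through the embedding \<open>cmat\<close>.\<close>

lemma msqrt_eqI: 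
  assumes "rhp X" "X ** X = cmat R" shows "msqrt R = mRe X"
  unfolding msqrt_def
proof (rule the_equality)
  have *: "cmat (mRe X) = X" by (rule rhp_sqrt_real[OF assms])
  then have "cmat (mRe X ** mRe X) = cmat R" using assms by (simp add: cmat_mult)
  then have "mRe X ** mRe X = R" by (metis mRe_cmat)
  then show "mRe X ** mRe X = R \<and> (\<forall>z. ceigenvalue (cmat (mRe X)) z \<longrightarrow> 0 < Re z)"
    using * assms(1) by (simp add: rhp_def)
next
  fix Y assume Y: "Y ** Y = R \<and> (\<forall>z. ceigenvalue (cmat Y) z \<longrightarrow> 0 < Re z)"
  then have "cmat Y ** cmat Y = X ** X" using assms by (simp flip: cmat_mult)
  then have "cmat Y = X" using rhp_sqrt_unique assms(1) Y unfolding rhp_def by blast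
  then show "Y = mRe X" by (metis mRe_cmat)
qed

subsection \<open>Powers of matrices with spectral radius below one\<close>

primrec mpow :: "complex^'n^'n \<Rightarrow> nat \<Rightarrow> complex^'n^'n" where
  "mpow B 0 = mat 1"
| "mpow B (Suc n) = B ** mpow B n"

lemma mpow_add: "mpow B (m + n) = mpow B m ** mpow B n"
  by (induction m) (simp_all add: matrix_mul_assoc)

lemma mpow_double: "mpow B (2 ^ Suc k) = mpow B (2 ^ k) ** mpow B (2 ^ k)"
  by (simp add: mult_2 flip: mpow_add)

lemma mpow_commute: "S ** B = B ** S \<Longrightarrow> S ** mpow B n = mpow B n ** S"
proof (induction n)
  case (Suc n)
  have "S ** mpow B (Suc n) = (B ** S) ** mpow B n"
    by (simp add: matrix_mul_assoc Suc.prems)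
  also have "\<dots> = B ** (mpow B n ** S)"
    by (simp add: Suc.IH[OF Suc.prems] flip: matrix_mul_assoc)
  finally show ?case by (simp add: matrix_mul_assoc)
qed simp

lemma norm_vector_smult: "norm (z *s v) = norm z * norm (v :: complex^'n)"
  by (simp add: norm_vec_def norm_mult L2_set_right_distrib)

text \<open>Carries decay along one link of a chain of generalised eigenvectors, with
  \<open>r\<close> the modulus of the eigenvalue and \<open>y\<close> the contribution of the
  shorter chain.\<close>

lemma tendsto_0_of_contraction:
  fixes x y :: "nat \<Rightarrow> real"
  assumes r: "0 \<le> r" "r < 1" and x: "\<And>n. 0 \<le> x n" "\<And>n. x (Suc n) \<le> r * x n + y n"
    and y: "y \<longlonglongrightarrow> 0"
  shows "x \<longlonglongrightarrow> 0"
proof (rule order_tendstoI)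
  fix e :: real assume e: "0 < e"
  \<comment> \<open>The threshold makes e / 2 the fixed point of t |-> r t + e (1 - r) / 2, so the
    accumulated perturbation never exceeds e / 2.\<close>
  have "\<forall>\<^sub>F n in sequentially. y n < e * (1 - r) / 2"
    using r e by (intro order_tendstoD(2)[OF y]) auto
  then obtain N where N: "\<And>n. n \<ge> N \<Longrightarrow> y n < e * (1 - r) / 2"
    by (auto simp: eventually_sequentially)
  have le: "x (k + N) \<le> r ^ k * x N + e / 2" for k
  proof (induction k)
    case (Suc k)
    have "x (Suc k + N) \<le> r * x (k + N) + y (k + N)" using x(2) by simp
    also have "\<dots> \<le> r * (r ^ k * x N + e / 2) + e * (1 - r) / 2"
      using Suc N[of "k + N"] r by (intro add_mono mult_left_mono) auto
    also have "\<dots> = r ^ Suc k * x N + e / 2" by (simp add: field_simps)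
    finally show ?case .
  qed (use e in auto)
  have "(\<lambda>k. r ^ k * x N) \<longlonglongrightarrow> 0 * x N"
    using r by (intro tendsto_mult LIMSEQ_realpow_zero tendsto_const)
  then have "\<forall>\<^sub>F k in sequentially. r ^ k * x N < e / 2"
    using e by (intro order_tendstoD(2)) auto
  then have "\<forall>\<^sub>F k in sequentially. x (k + N) < e"
    by eventually_elim (use le in \<open>smt (verit) field_sum_of_halves\<close>)
  then show "\<forall>\<^sub>F n in sequentially. x n < e"
    by (subst (asm) eventually_sequentially_seg)
next
  fix a :: real assume "a < 0"
  then show "\<forall>\<^sub>F n in sequentially. a < x n"
    using x(1) by (intro always_eventually allI) (meson less_le_trans)
qed

text \<open>With x_n = B^n v and y_n = B^n (B - z) v one has x_(n+1) = z x_n + y_n. The induction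
  hypothesis gives y_n -> 0, and |z| < 1 makes the recursion a contraction.\<close>

lemma mpow_tendsto_0:
  fixes B :: "complex^'n^'n"
  assumes "\<And>z. ceigenvalue B z \<Longrightarrow> norm z < 1"
  shows "mpow B \<longlonglongrightarrow> 0"
proof -
  obtain ls where ls: "\<forall>z\<in>set ls. ceigenvalue B z" "mpoly (fac ls) B = 0"
    using ex_eigenvalue_list by blast
  have "\<forall>z\<in>set ls. norm z < 1" using ls(1) assms by auto
  then have *: "(\<lambda>n. mpow B n *v v) \<longlonglongrightarrow> 0" if "mpoly (fac ls) B *v v = 0" for v
    using that
  proof (induction ls arbitrary: v)
    case (Cons z ls)
    let ?x = "\<lambda>n. mpow B n *v v" and ?y = "\<lambda>n. mpow B n *v (B *v v - z *s v)"
    have y: "?y \<longlonglongrightarrow> 0" using Cons by (simp add: mpoly_fac_Cons del: fac_simps)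
    have eq: "?x (Suc n) = z *s ?x n + ?y n" for n
      using mpow_commute[of B B n]
      by (simp add: mv.diff_right vec.scale matrix_vector_mul_assoc)
    have "norm (?x (Suc n)) \<le> norm z * norm (?x n) + norm (?y n)" for n
    proof -
      have "norm (?x (Suc n)) \<le> norm (z *s ?x n) + norm (?y n)"
        by (subst eq) (rule norm_triangle_ineq)
      then show ?thesis by (simp only: norm_vector_smult)
    qed
    then have "(\<lambda>n. norm (?x n)) \<longlonglongrightarrow> 0"
      using Cons.prems(1) by (intro tendsto_0_of_contraction[OF _ _ _ _ tendsto_norm_zero[OF y], of "norm z"]) auto
    then show ?case by (rule tendsto_norm_zero_cancel)
  qed simp
  have "(\<lambda>n. mpow B n *v axis j 1) \<longlonglongrightarrow> 0" for j by (rule *) (simp add: ls(2))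
  then have "(\<lambda>n. (mpow B n *v axis j 1) $ i) \<longlonglongrightarrow> 0 $ i" for i j
    by (rule tendsto_vec_nth)
  then have "(\<lambda>n. mpow B n $ i $ j) \<longlonglongrightarrow> 0" for i j
    by (simp add: matrix_vector_mult_def axis_def if_distrib sum.delta cong: if_cong)
  then show ?thesis by (intro vec_tendstoI) simp
qed

text \<open>A kernel vector satisfies B^m v = v or B^m v = - v. Either way B^(2m) fixes v, hence so
  do all its powers, and these tend to zero.\<close>

lemma invertible_one_minus_plus:
  assumes "mpow B \<longlonglongrightarrow> 0" "m > 0"
  shows "invertible (mat 1 - mpow B m)" "invertible (mat 1 + mpow B m)"
proof -
  have *: "v = 0" if v: "mpow B m *v (mpow B m *v v) = v" for v
  proof -
    have "mpow B (k * (m + m)) *v v = v" for k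
      by (induction k) (simp_all add: mpow_add v flip: matrix_vector_mul_assoc)
    then have const: "(\<lambda>k. mpow B (k * (m + m)) *v v) = (\<lambda>k. v)" by simp
    have "filterlim (\<lambda>k. k * (m + m)) sequentially sequentially"
      by (intro filterlim_subseq strict_monoI) (use assms(2) in auto)
    then have "(\<lambda>k. mpow B (k * (m + m)) *v v) \<longlonglongrightarrow> 0 *v v"
      by (intro mv.tendsto tendsto_const filterlim_compose[OF assms(1)])
    then show ?thesis unfolding const by (simp add: LIMSEQ_const_iff)
  qed
  show "invertible (mat 1 - mpow B m)"
    by (intro invertibleI_ker *) (simp add: mv.diff_left)
  show "invertible (mat 1 + mpow B m)"
  proof (intro invertibleI_ker *)
    fix v assume "(mat 1 + mpow B m) *v v = 0"
    then have "mpow B m *v v = - v" by (simp add: mv.add_left add_eq_0_iff)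
    then show "mpow B m *v (mpow B m *v v) = v" by (simp add: mv.minus_right)
  qed
qed

subsection \<open>Convergence of the iterations\<close>

lemma matrix_inv_mult [simp]:
  assumes "invertible M" shows "M ** matrix_inv M = mat 1" "matrix_inv M ** M = mat 1"
  using someI_ex[of "\<lambda>A'. M ** A' = mat 1 \<and> A' ** M = mat 1"] assms
  by (auto simp: matrix_inv_def invertible_def)

lemma matrix_inv_eqI: 
  fixes M :: "'a::field^'n^'n"
  assumes "M ** N = mat 1" shows "invertible M" "matrix_inv M = N"
proof -
  show "invertible M" using assms matrix_left_right_inverse by (auto simp: invertible_def)
  then have "matrix_inv M ** (M ** N) = N" by (simp add: matrix_mul_assoc)
  then show "matrix_inv M = N" by (simp add: assms)
qed

lemma matrix_inv_commute:
  assumes "invertible M" "M ** N = N ** M"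
  shows "matrix_inv M ** N = N ** matrix_inv M"
proof -
  have "matrix_inv M ** (M ** N) ** matrix_inv M = matrix_inv M ** (N ** M) ** matrix_inv M"
    by (simp add: assms(2))
  then show ?thesis
    using assms(1) by (metis matrix_inv_mult matrix_mul_assoc matrix_mul_lid matrix_mul_rid)
qed

lemma rhp_invertible: "rhp S \<Longrightarrow> invertible S"
  by (rule invertibleI_ker) (force simp: rhp_def ceigenvalue_def)

lemma rhp_cmat_invertible:
  assumes "rhp (cmat R)" shows "invertible R"
proof -
  have "mRe (cmat R ** matrix_inv (cmat R)) = mat 1" using rhp_invertible[OF assms] by simp
  then have "R ** mRe (matrix_inv (cmat R)) = mat 1" by (simp add: mRe_mult mm.zero_left)
  then show ?thesis by (rule matrix_inv_eqI)
qed

lemma invertible_factor: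
  fixes X :: "'a::field^'n^'n"
  assumes "X ** U = V" "invertible U" "invertible V" shows "invertible X"
proof -
  have "X = V ** matrix_inv U"
    using assms(1,2) by (metis matrix_inv_mult(1) matrix_mul_assoc matrix_mul_rid)
  then show ?thesis
    using assms(2,3) by (metis invertible_def invertible_mult matrix_inv_mult)
qed

text \<open>The Cayley transform \<open>(S - 1) (S + 1)\<^sup>-\<^sup>1\<close> turns the Newton iteration into squaring.\<close>

lemma ex_cayley:
  fixes S :: "complex^'n^'n"
  assumes "rhp S"
  shows "\<exists>B. S ** B = B ** S \<and> S ** S ** (mat 1 - B) = S ** (mat 1 + B) \<and> mpow B \<longlonglongrightarrow> 0"
proof -
  have "invertible (S + mat 1)"
  proof (rule invertibleI_ker)
    fix v assume "(S + mat 1) *v v = 0"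
    then have "S *v v = (-1) *s v" by (simp add: mv.add_left add_eq_0_iff2)
    moreover have "\<not> ceigenvalue S (-1)" using assms by (force simp: rhp_def)
    ultimately show "v = 0" by (blast dest: not_eigenvalueD)
  qed
  define N where "N = matrix_inv (S + mat 1)"
  note inv = matrix_inv_mult[OF \<open>invertible (S + mat 1)\<close>, folded N_def]
  have SN: "S ** N = N ** S"
    unfolding N_def by (rule matrix_inv_commute[symmetric]) (use \<open>invertible (S + mat 1)\<close> in \<open>simp_all add: mm_distribs\<close>)
  have SN1: "S ** N = mat 1 - N" using inv(1) by (simp add: mm_distribs algebra_simps)
  define B where "B = (S - mat 1) ** N"
  have B: "B = mat 1 - 2 *\<^sub>R N"
    by (simp add: B_def mm_distribs SN1 scaleR_2)
  have "S ** B = B ** S"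
    unfolding B by (simp add: mm_distribs mm.scaleR_left mm.scaleR_right SN)
  moreover have "S ** (mat 1 - B) = mat 1 + B"
    unfolding B by (simp add: mm.scaleR_right SN1 scaleR_right_diff_distrib) (simp add: scaleR_2)
  \<comment> \<open>This is the invariant of the Newton iteration at k = 0, where the iterate is S^2
    and the exponent of B is 2^0 = 1.\<close>
  then have "S ** S ** (mat 1 - B) = S ** (mat 1 + B)"
    by (simp flip: matrix_mul_assoc)
  moreover have "mpow B \<longlonglongrightarrow> 0"
  proof (rule mpow_tendsto_0)
    fix z assume "ceigenvalue B z"
    then obtain v where v: "v \<noteq> 0" "B *v v = z *s v" by (auto simp: ceigenvalue_def)
    \<comment> \<open>Inverts the Cayley transform on the eigenvector: v = (S + 1) w and B v = (S -
      1) w, so w is an eigenvector of S with eigenvalue (1 + z) / (1 - z).\<close>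
    define w where "w = N *v v"
    have vw: "v = S *v w + w"
      using inv(1) by (simp add: w_def matrix_vector_mul_assoc mm.add_left flip: mv.add_left)
    have w: "w \<noteq> 0" using v(1) vw by auto
    have "S *v w - w = z *s (S *v w + w)"
      using v(2) unfolding vw[symmetric]
      by (simp add: B_def w_def matrix_vector_mul_assoc mm.diff_left flip: mv.diff_left)
    then have eq: "(1 - z) *s (S *v w) = (1 + z) *s w"
      by (simp add: vec.scale_right_distrib vec.scale_left_distrib vec.scale_left_diff_distrib
          algebra_simps)
    have "z \<noteq> 1"
    proof
      assume z: "z = 1"
      have "(1 + z) *s w = 0" unfolding eq[symmetric] by (simp add: z)
      then have "1 + z = 0 \<or> w = 0" by (simp only: vec.scale_eq_0_iff)
      then show False using z w by simp
    qed
    then have "S *v w = (1 / (1 - z) * (1 - z)) *s (S *v w)" by simp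
    also have "\<dots> = ((1 + z) / (1 - z)) *s w"
      unfolding vec.scale_scale[symmetric] eq by (simp only: vec.scale_scale) simp
    finally have "S *v w = ((1 + z) / (1 - z)) *s w" .
    then have "Re ((1 + z) / (1 - z)) > 0" using assms w unfolding rhp_def ceigenvalue_def by blast
    \<comment> \<open>This real part equals 1 - |z|^2.\<close>
    then have "Re ((1 + z) * cnj (1 - z)) > 0"
      by (simp add: Re_complex_div_gt_0)
    then have "(norm z)\<^sup>2 < 1" 
      unfolding cmod_power2 by (simp add: algebra_simps power2_eq_square)
    then show "norm z < 1" by (simp add: power_less_one_iff)
  qed
  ultimately show ?thesis by blast
qed

lemma newton_iter_commute:
  assumes "\<And>k. invertible (newton_iter M k)"
  shows "newton_iter M k ** M = M ** newton_iter M k"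
proof (induction k)
  case (Suc k)
  have "M ** matrix_inv (newton_iter M k) = matrix_inv (newton_iter M k) ** M"
    by (rule matrix_inv_commute[OF assms Suc, symmetric])
  then show ?case
    by (simp add: mm.scaleR_left mm.scaleR_right mm_distribs Suc matrix_mul_assoc)
qed simp

lemma newton_iter_converges:
  fixes S :: "complex^'n^'n"
  assumes S: "rhp S" and M: "S ** S = M"
  shows "invertible (newton_iter M k)" "newton_iter M \<longlonglongrightarrow> S"
proof -
  obtain B where B: "S ** B = B ** S" "S ** S ** (mat 1 - B) = S ** (mat 1 + B)" "mpow B \<longlonglongrightarrow> 0"
    using ex_cayley[OF S] by blast
  define C where "C k = mpow B (2 ^ k)" for k
  let ?X = "newton_iter M"
  note inv1 = invertible_one_minus_plus[OF B(3), of "2 ^ _", folded C_def, simplified]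
  have SC: "S ** C k = C k ** S" for k unfolding C_def by (rule mpow_commute[OF B(1)])
  \<comment> \<open>Conditional on the invariant at k, because the induction step for the invariant
    already needs the inverse of the k-th iterate.\<close>
  have invX: "invertible (?X k)" if "?X k ** (mat 1 - C k) = S ** (mat 1 + C k)" for k
    using that inv1 rhp_invertible[OF S] by (blast intro: invertible_factor invertible_mult)
  have X: "?X k ** (mat 1 - C k) = S ** (mat 1 + C k)" for k
  proof (induction k)
    case 0
    then show ?case using B(2) by (simp add: C_def M[symmetric])
  next
    case (Suc k)
    let ?C = "C k" and ?I = "matrix_inv (?X k)"
    note inv = matrix_inv_mult[OF invX[OF Suc]]
    have comm: "(mat 1 + ?C) ** (mat 1 - ?C) = mat 1 - ?C ** ?C"
      "(mat 1 - ?C) ** (mat 1 + ?C) = mat 1 - ?C ** ?C"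
      by (simp_all add: mm_distribs)
    have CS: "(mat 1 + ?C) ** S = S ** (mat 1 + ?C)" "(mat 1 - ?C) ** S = S ** (mat 1 - ?C)"
      by (simp_all add: mm_distribs SC)
    \<comment> \<open>Multiplied by 1 - C^2, the two terms of the Newton step become S (1 + C)^2 and
      S (1 - C)^2. In their mean the terms linear in C cancel, leaving S (1 + C^2).\<close>
    have "?X k ** (mat 1 - ?C ** ?C) = S ** (mat 1 + ?C) ** (mat 1 + ?C)"
      unfolding comm(2)[symmetric] by (simp add: matrix_mul_assoc Suc)
    moreover have "?I ** M ** (mat 1 - ?C ** ?C) = S ** (mat 1 - ?C) ** (mat 1 - ?C)"
    proof -
      have "?I ** M ** (mat 1 - ?C ** ?C) = ?I ** (S ** (S ** (mat 1 + ?C)) ** (mat 1 - ?C))"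
        by (simp add: M[symmetric] matrix_mul_assoc flip: comm(1))
      also have "\<dots> = ?I ** ((S ** (mat 1 + ?C)) ** (S ** (mat 1 - ?C)))"
        by (simp add: matrix_mul_assoc flip: CS(1))
      also have "\<dots> = ?I ** (?X k ** (mat 1 - ?C) ** (S ** (mat 1 - ?C)))"
        by (simp only: Suc)
      also have "\<dots> = (mat 1 - ?C) ** (S ** (mat 1 - ?C))"
        by (simp add: matrix_mul_assoc inv)
      finally show ?thesis by (simp add: matrix_mul_assoc CS(2))
    qed
    ultimately have "?X (Suc k) ** (mat 1 - ?C ** ?C) =
        (1/2) *\<^sub>R (S ** (mat 1 + ?C) ** (mat 1 + ?C) + S ** (mat 1 - ?C) ** (mat 1 - ?C))"
      by (simp add: mm.scaleR_left mm.add_left)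
    also have "S ** (mat 1 + ?C) ** (mat 1 + ?C) + S ** (mat 1 - ?C) ** (mat 1 - ?C) =
        S ** (mat 1 + ?C ** ?C) + S ** (mat 1 + ?C ** ?C)"
      by (simp add: mm_distribs matrix_mul_assoc)
    finally have "?X (Suc k) ** (mat 1 - ?C ** ?C) = S ** (mat 1 + ?C ** ?C)" by simp
    then show ?case by (simp only: C_def mpow_double)
  qed
  show "invertible (newton_iter M k)" by (rule invX[OF X])
  obtain K where K: "K > 0" "\<And>(U :: complex^'n^'n) (V :: complex^'n^'n). norm (U ** V) \<le> norm U * norm V * K"
    using bounded_bilinear.pos_bounded[OF bounded_bilinear_matrix_mult[where 'a = complex and 'n = 'n]]
    by auto
  have C0: "C \<longlonglongrightarrow> 0"
    unfolding C_def by (intro filterlim_compose[OF B(3)] filterlim_subseq strict_monoI) auto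
  have "\<forall>\<^sub>F k in sequentially. norm (C k) < 1 / (2 * K)"
    using K(1) by (intro order_tendstoD(2)[OF tendsto_norm_zero[OF C0]]) auto
  then have "\<forall>\<^sub>F k in sequentially. norm (?X k - S) \<le> 4 * norm S * K * norm (C k)"
  proof eventually_elim
    case (elim k)
    \<comment> \<open>A rearrangement of the invariant that avoids bounding the inverse of 1 - C:
      since K |C| < 1/2, the last term is absorbed on the left, which doubles the factor 2 to
      4.\<close>
    have eq: "?X k - S = 2 *\<^sub>R (S ** C k) + (?X k - S) ** C k"
      using X[of k] by (simp add: mm_distribs scaleR_2 algebra_simps)
    have "norm (?X k - S) \<le> norm (2 *\<^sub>R (S ** C k)) + norm ((?X k - S) ** C k)"
      by (subst eq) (rule norm_triangle_ineq)
    also have "\<dots> \<le> 2 * (norm S * norm (C k) * K) + norm (?X k - S) * norm (C k) * K"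
      using K(2)[of S "C k"] K(2)[of "?X k - S" "C k"] by simp
    also have "norm (?X k - S) * norm (C k) * K \<le> norm (?X k - S) * (1 / 2)"
      unfolding mult.assoc using elim K(1) by (intro mult_left_mono) (auto simp: field_simps)
    finally show ?case by (simp add: algebra_simps)
  qed
  moreover have "(\<lambda>k. 4 * norm S * K * norm (C k)) \<longlonglongrightarrow> 0"
    using tendsto_mult_right_zero[OF tendsto_norm_zero[OF C0]] by simp
  ultimately have "(\<lambda>k. ?X k - S) \<longlonglongrightarrow> 0" by (rule Lim_null_comparison)
  then show "?X \<longlonglongrightarrow> S" by (rule LIM_zero_cancel)
qed

text \<open>Write X for the Newton iterate. It commutes with M, so the inverse of M^-1 X is X^-1 M,
  which gives the Newton step for the first component; and M^-1 (X^-1 M) = X^-1 gives M^-1 times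
  that step for the second.\<close>

lemma db_iter_eq:
  fixes S :: "complex^'n^'n"
  assumes S: "rhp S" and M: "S ** S = M"
  shows "db_iter M k = (newton_iter M k, matrix_inv M ** newton_iter M k)"
proof (induction k)
  case 0
  have "invertible M" using rhp_invertible[OF S] M invertible_mult by blast
  then show ?case by simp
next
  case (Suc k)
  let ?X = "newton_iter M k"
  have M': "invertible M" using rhp_invertible[OF S] M invertible_mult by blast
  have X: "invertible ?X" by (rule newton_iter_converges(1)[OF assms])
  have comm: "?X ** M = M ** ?X" by (intro newton_iter_commute newton_iter_converges(1)[OF assms])
  have "(matrix_inv M ** ?X) ** (matrix_inv ?X ** M) = mat 1"
    using X M' by (metis matrix_inv_mult matrix_mul_assoc matrix_mul_rid)
  then have "matrix_inv (matrix_inv M ** ?X) = matrix_inv ?X ** M" by (rule matrix_inv_eqI)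
  moreover have "matrix_inv M ** (matrix_inv ?X ** M) = matrix_inv ?X"
    unfolding matrix_inv_commute[OF X comm] using M' by (simp add: matrix_mul_assoc)
  ultimately show ?case
    by (simp add: Suc mm.scaleR_right mm.add_right Let_def)
qed

lemma db_iter_converges:
  fixes S :: "complex^'n^'n"
  assumes S: "rhp S" and M: "S ** S = M"
  shows "invertible (fst (db_iter M k))" "invertible (snd (db_iter M k))"
    "(\<lambda>k. fst (db_iter M k)) \<longlonglongrightarrow> S" "(\<lambda>k. snd (db_iter M k)) \<longlonglongrightarrow> matrix_inv S"
proof -
  note S' = rhp_invertible[OF S]
  have M': "invertible M" using S' M invertible_mult by blast
  have invM: "invertible (matrix_inv M)" using M' by (metis invertible_def matrix_inv_mult)
  note conv = newton_iter_converges[OF assms]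
  note [simp] = db_iter_eq[OF assms]
  show "invertible (fst (db_iter M k))" "invertible (snd (db_iter M k))"
    using conv(1) invM invertible_mult by auto
  show "(\<lambda>k. fst (db_iter M k)) \<longlonglongrightarrow> S" using conv(2) by simp
  have "S ** (matrix_inv M ** S) = (S ** matrix_inv M) ** S" by (simp add: matrix_mul_assoc)
  also have "S ** matrix_inv M = matrix_inv M ** S"
    by (rule matrix_inv_commute[OF M', symmetric]) (simp add: M[symmetric] matrix_mul_assoc)
  also have "\<dots> ** S = mat 1" using M' by (simp add: M flip: matrix_mul_assoc)
  finally have "matrix_inv S = matrix_inv M ** S" by (rule matrix_inv_eqI)
  then show "(\<lambda>k. snd (db_iter M k)) \<longlonglongrightarrow> matrix_inv S"
    using conv(2) by (simp add: mm.tendsto)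
qed

subsection \<open>Continuity of the principal square root\<close>

text \<open>Compactness: |S v - z v| has a positive minimum m over unit vectors v and bounded z in
  the closed left half-plane. An eigenpair of X there would make |(S - X) v| at least m.\<close>

lemma eventually_rhp:
  fixes S :: "complex^'n^'n"
  assumes "rhp S" shows "\<forall>\<^sub>F X in nhds S. rhp X"
proof -
  obtain K where K: "K > 0" "\<And>(U :: complex^'n^'n) (v :: complex^'n). norm (U *v v) \<le> norm U * norm v * K"
    using bounded_bilinear.pos_bounded[OF bounded_bilinear_matrix_vector_mult[where 'a = complex and 'n = 'n]]
    by auto
  \<comment> \<open>Bounds every eigenvalue of every X within distance 1 of S, so that the relevant
    pairs (v, z) form a compact set.\<close>
  define R where "R = (norm S + 1) * K"
  define T :: "((complex^'n) \<times> complex) set" where "T = sphere 0 1 \<times> (cball 0 R \<inter> {z. Re z \<le> 0})"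
  have "R \<ge> 0" using K(1) by (simp add: R_def)
  obtain v0 :: "complex^'n" where "norm v0 = 1" using vector_choose_size[of 1] by auto
  then have "(v0, 0) \<in> T" using \<open>R \<ge> 0\<close> by (simp add: T_def)
  then have "T \<noteq> {}" by blast
  moreover have "compact T"
    unfolding T_def by (intro compact_Times compact_Int_closed closed_halfspace_Re_le) auto
  moreover have "continuous_on T (\<lambda>(v, z). norm (S *v v - z *s v))"
    unfolding case_prod_unfold matrix_vector_mult_def vector_scalar_mult_def
    by (intro continuous_intros)
  ultimately obtain p where p: "p \<in> T" "\<And>q. q \<in> T \<Longrightarrow> (\<lambda>(v, z). norm (S *v v - z *s v)) p \<le> (\<lambda>(v, z). norm (S *v v - z *s v)) q"
    using continuous_attains_inf[of T] by meson
  define m where "m = (\<lambda>(v, z). norm (S *v v - z *s v)) p"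
  have m: "m \<le> norm (S *v v - z *s v)" if "(v, z) \<in> T" for v z
    using p(2)[OF that] by (simp add: m_def)
  obtain v z where vz: "p = (v, z)" by fastforce
  have "v \<noteq> 0" "Re z \<le> 0" using p(1) by (auto simp: vz T_def)
  then have "S *v v \<noteq> z *s v" using assms unfolding rhp_def ceigenvalue_def by force
  then have "m > 0" by (simp add: m_def vz)
  have "\<forall>\<^sub>F X in nhds S. dist X S < min 1 (m / K)"
    unfolding eventually_nhds_metric
    using \<open>m > 0\<close> K(1) by (intro exI[of _ "min 1 (m / K)"]) auto
  then show ?thesis
  proof eventually_elim
    case (elim X)
    then have near: "norm (S - X) < 1" "norm (S - X) * K < m"
      using K(1) by (auto simp: dist_norm norm_minus_commute field_simps)
    have "Re z > 0" if z: "ceigenvalue X z" for z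
    proof (rule ccontr)
      assume neg: "\<not> Re z > 0"
      obtain v where v: "v \<noteq> 0" "X *v v = z *s v" using z by (auto simp: ceigenvalue_def)
      define u where "u = (1 / norm v) *\<^sub>R v"
      have u: "norm u = 1" using v(1) by (simp add: u_def)
      have Xu: "X *v u = z *s u" 
        using v(2) by (simp add: u_def mv.scaleR_right vec_eq_iff)
      have "norm z = norm (X *v u)" by (simp add: Xu norm_vector_smult u)
      also have "\<dots> \<le> norm X * K" using K(2)[of X u] u by simp
      also have "\<dots> \<le> R"
        using near(1) norm_triangle_ineq3[of S X] K(1) unfolding R_def by (intro mult_right_mono) auto
      finally have "(u, z) \<in> T" using u neg by (simp add: T_def)
      then have "m \<le> norm ((S - X) *v u)" using m Xu by (simp add: mv.diff_left)
      also have "\<dots> \<le> norm (S - X) * K" using K(2)[of "S - X" u] u by simp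
      finally show False using near(2) by simp
    qed
    then show ?case by (simp add: rhp_def)
  qed
qed

text \<open>In finite dimension injectivity gives a two-sided inverse. As a right inverse G serves
  the open mapping argument, as a left inverse it is the derivative of the square root.\<close>

lemma ex_sylvester_inverse:
  fixes S :: "'a::{euclidean_space,real_algebra_1}^'n^'n"
  assumes "\<And>D. S ** D + D ** S = 0 \<Longrightarrow> D = 0"
  shows "\<exists>G. bounded_linear G \<and> (\<forall>D. G (S ** D + D ** S) = D) \<and> (\<forall>E. S ** G E + G E ** S = E)"
proof -
  let ?f = "\<lambda>D. S ** D + D ** S"
  have lin: "linear ?f"
    by (intro linearI) (simp_all add: mm_distribs mm.scaleR_left mm.scaleR_right scaleR_right_distrib)
  have "inj ?f"
    unfolding linear_injective_0[OF lin] using assms by blast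
  then obtain G where "linear G" "\<forall>x. G (?f x) = x" "\<forall>x. ?f (G x) = x"
    using linear_injective_isomorphism[OF lin] by blast
  then show ?thesis using linear_conv_bounded_linear by blast
qed

lemma has_derivative_matrix_square:
  "((\<lambda>X. X ** X) has_derivative (\<lambda>D. S ** D + D ** S)) (at (S :: 'a::{euclidean_space,real_algebra_1}^'n^'n))"
  using mm.FDERIV[OF has_derivative_ident has_derivative_ident, of S UNIV] by simp

text \<open>The derivative of squaring at S has the right inverse G, so squaring maps a
  neighbourhood of S onto a neighbourhood of its square. The neighbourhood of S is first shrunk to
  matrices with \<open>rhp\<close> within distance e.\<close>

lemma eventually_rhp_sqrt_near:
  fixes S :: "complex^'n^'n"
  assumes S: "rhp S" and e: "e > 0"
  shows "\<forall>\<^sub>F M in nhds (S ** S). \<exists>X. X ** X = M \<and> rhp X \<and> dist X S < e"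
proof -
  let ?f = "\<lambda>X :: complex^'n^'n. X ** X"
  have "\<forall>\<^sub>F X in nhds S. rhp X \<and> dist X S < e"
    using eventually_rhp[OF S] e
    by (intro eventually_conj) (auto intro!: eventually_nhds_metric[THEN iffD2])
  then obtain T where T: "open T" "S \<in> T" "\<And>X. X \<in> T \<Longrightarrow> rhp X \<and> dist X S < e"
    unfolding eventually_nhds by blast
  obtain G where G: "bounded_linear G" "\<forall>E. S ** G E + G E ** S = E"
    using ex_sylvester_inverse[of S] sylvester_injective[OF S S] by blast
  have "?f S \<in> interior (?f ` T)"
  proof (rule sussmann_open_mapping[of UNIV])
    show "continuous_on UNIV ?f"
      by (intro mm.continuous_on continuous_on_id)
    show "(?f has_derivative (\<lambda>D. S ** D + D ** S)) (at S)" by (rule has_derivative_matrix_square)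
    show "(\<lambda>D. S ** D + D ** S) \<circ> G = id" using G(2) by auto
  qed (use T G interior_open in auto)
  then have "\<forall>\<^sub>F M in nhds (S ** S). M \<in> interior (?f ` T)"
    by (intro eventually_nhds_in_open) auto
  then show ?thesis
    by eventually_elim (use T interior_subset in blast)
qed

text \<open>The choice is forced by \<open>rhp_sqrt_unique\<close> whenever a root with
  \<open>rhp\<close> exists; elsewhere the value is arbitrary.\<close>

definition psqrt :: "complex^'n^'n \<Rightarrow> complex^'n^'n" where
  "psqrt M = (SOME X. X ** X = M \<and> rhp X)"

lemma psqrt_square: assumes "rhp X" shows "psqrt (X ** X) = X"
  unfolding psqrt_def by (rule some_equality) (use assms rhp_sqrt_unique in auto)

lemma eventually_psqrt:
  assumes "rhp S"
  shows "\<forall>\<^sub>F M in nhds (S ** S). rhp (psqrt M) \<and> psqrt M ** psqrt M = M"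
  using eventually_rhp_sqrt_near[OF assms zero_less_one]
  by eventually_elim (auto simp: psqrt_square)

lemma tendsto_psqrt:
  assumes "rhp S" shows "(psqrt \<longlongrightarrow> S) (nhds (S ** S))"
proof (rule tendstoI)
  fix e :: real assume "e > 0"
  from eventually_rhp_sqrt_near[OF assms this]
  show "\<forall>\<^sub>F M in nhds (S ** S). dist (psqrt M) S < e"
    by eventually_elim (auto simp: psqrt_square)
qed

lemma tendsto_cmat: "(cmat \<longlongrightarrow> cmat A) (nhds A)"
  using bounded_linear.tendsto[OF bounded_linear_cmat tendsto_ident_at, of A UNIV]
  by (simp add: tendsto_at_iff_tendsto_nhds)

text \<open>Differentiating \<open>msqrt\<close> as an inverse function requires that squaring
  undoes it on a whole neighbourhood, not just at one point.\<close>

lemma eventually_msqrt: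
  assumes R: "rhp (cmat R)"
  shows "\<forall>\<^sub>F A in nhds (R ** R). msqrt A = mRe (psqrt (cmat A)) \<and> msqrt A ** msqrt A = A"
proof -
  have "\<forall>\<^sub>F A in nhds (R ** R). rhp (psqrt (cmat A)) \<and> psqrt (cmat A) ** psqrt (cmat A) = cmat A"
    using filterlim_iff[THEN iffD1, OF tendsto_cmat[of "R ** R"], rule_format] eventually_psqrt[OF R]
    by (simp add: cmat_mult)
  then show ?thesis
  proof eventually_elim
    case (elim A)
    have eq: "msqrt A = mRe (psqrt (cmat A))" using elim by (intro msqrt_eqI) auto
    moreover have "cmat (msqrt A) = psqrt (cmat A)"
      unfolding eq using elim by (intro rhp_sqrt_real) auto
    then have "cmat (msqrt A ** msqrt A) = cmat A" using elim by (simp add: cmat_mult)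
    then have "msqrt A ** msqrt A = A" by (metis mRe_cmat)
    ultimately show ?case by simp
  qed
qed

lemma msqrt_square: "rhp (cmat R) \<Longrightarrow> msqrt (R ** R) = R"
  using msqrt_eqI[of "cmat R" "R ** R"] by (simp add: cmat_mult)

lemma continuous_msqrt:
  assumes R: "rhp (cmat R)" shows "continuous (at (R ** R)) msqrt"
proof -
  have "((\<lambda>A. mRe (psqrt (cmat A))) \<longlongrightarrow> mRe (cmat R)) (nhds (R ** R))"
    using filterlim_compose[OF tendsto_psqrt[OF R] tendsto_cmat[of "R ** R", unfolded cmat_mult]]
    by (rule bounded_linear.tendsto[OF bounded_linear_mRe])
  moreover have "\<forall>\<^sub>F A in nhds (R ** R). mRe (psqrt (cmat A)) = msqrt A"
    using eventually_msqrt[OF R] by eventually_elim simp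
  ultimately have "(msqrt \<longlongrightarrow> mRe (cmat R)) (nhds (R ** R))"
    by (rule Lim_transform_eventually)
  then have "(msqrt \<longlongrightarrow> R) (nhds (R ** R))" by simp
  then show ?thesis
    unfolding continuous_at isCont_def msqrt_square[OF R] by (rule filterlim_mono[OF _ order_refl at_within_le_nhds])
qed

text \<open>Inverse function rule: \<open>msqrt\<close> is continuous and squaring undoes it near
  R^2, so its derivative inverts the Sylvester operator. In direction E it is the solution L of R L
  + L R = E.\<close>

lemma has_derivative_msqrt:
  assumes R: "rhp (cmat R)" and G: "bounded_linear G" "\<And>D. G (R ** D + D ** R) = D"
  shows "(msqrt has_derivative G) (at (R ** R))"
proof -
  obtain T where T: "open T" "R ** R \<in> T" "\<And>A. A \<in> T \<Longrightarrow> msqrt A ** msqrt A = A"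
    using eventually_msqrt[OF R] unfolding eventually_nhds by blast
  show ?thesis
  proof (rule has_derivative_inverse_basic[where f = "\<lambda>X. X ** X" and T = T])
    show "((\<lambda>X. X ** X) has_derivative (\<lambda>D. R ** D + D ** R)) (at (msqrt (R ** R)))"
      unfolding msqrt_square[OF R] by (rule has_derivative_matrix_square)
  qed (use T G continuous_msqrt[OF R] in auto)
qed

subsection \<open>Derivative of the matrix inverse\<close>

text \<open>With T = R^-1 and D = T (X - R) one has T X = 1 + D. For small D a kernel vector of X
  satisfies |v| <= |v| / 2, and T = W + D W for W = X^-1 gives |W| <= 2 |T|.\<close>

lemma matrix_inv_near:
  fixes R :: "'a::{euclidean_space,real_normed_field}^'n^'n"
  assumes R: "invertible R"
  shows "\<exists>B. \<forall>\<^sub>F X in nhds R. invertible X \<and> norm (matrix_inv X) \<le> B"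
proof -
  let ?T = "matrix_inv R"
  obtain K where K: "K > 0" "\<And>(U :: 'a^'n^'n) (V :: 'a^'n^'n). norm (U ** V) \<le> norm U * norm V * K"
    using bounded_bilinear.pos_bounded[OF bounded_bilinear_matrix_mult[where 'a = 'a and 'n = 'n]]
    by auto
  obtain L where L: "L > 0" "\<And>(U :: 'a^'n^'n) (v :: 'a^'n). norm (U *v v) \<le> norm U * norm v * L"
    using bounded_bilinear.pos_bounded[OF bounded_bilinear_matrix_vector_mult[where 'a = 'a and 'n = 'n]]
    by auto
  have lim: "((\<lambda>X. ?T ** (X - R)) \<longlongrightarrow> ?T ** (R - R)) (nhds R)"
    by (intro mm.tendsto tendsto_intros filterlim_ident)
  \<comment> \<open>One smallness condition serves both the matrix product constant K and the
    matrix-vector constant L.\<close>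
  have "((\<lambda>X. norm (?T ** (X - R)) * (K + L)) \<longlongrightarrow> norm (?T ** (R - R)) * (K + L)) (nhds R)"
    by (intro tendsto_intros lim)
  then have "\<forall>\<^sub>F X in nhds R. norm (?T ** (X - R)) * (K + L) < 1 / 2"
    by (rule order_tendstoD(2)) (simp add: mm.zero_right)
  then have "\<forall>\<^sub>F X in nhds R. invertible X \<and> norm (matrix_inv X) \<le> 2 * norm ?T"
  proof eventually_elim
    case (elim X)
    let ?D = "?T ** (X - R)"
    have D: "norm ?D * K \<le> 1 / 2" "norm ?D * L \<le> 1 / 2"
      using elim mult_nonneg_nonneg[OF norm_ge_zero[of ?D], of K] mult_nonneg_nonneg[OF norm_ge_zero[of ?D], of L]
        K(1) L(1) unfolding distrib_left by linarith+
    have TX: "?T ** X = mat 1 + ?D" using R by (simp add: mm_distribs)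
    have inv: "invertible X"
    proof (rule invertibleI_ker)
      fix v assume "X *v v = 0"
      then have "(?T ** X) *v v = 0" by (simp flip: matrix_vector_mul_assoc)
      then have "v = - (?D *v v)" unfolding TX by (simp add: mv.add_left add_eq_0_iff2)
      then have "norm v = norm (?D *v v)" by (metis norm_minus_cancel)
      also have "\<dots> \<le> norm v * (norm ?D * L)" using L(2)[of ?D v] by (simp add: mult_ac)
      also have "\<dots> \<le> norm v * (1 / 2)" by (intro mult_left_mono D) auto
      finally show "v = 0" by simp
    qed
    let ?W = "matrix_inv X"
    have "?T = (?T ** X) ** ?W" using inv by (simp flip: matrix_mul_assoc)
    also have "\<dots> = ?W + ?D ** ?W" unfolding TX by (simp add: mm_distribs)
    finally have "norm ?W \<le> norm ?T + norm (?D ** ?W)"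
      by (metis add_diff_cancel_right' norm_triangle_ineq4)
    also have "norm (?D ** ?W) \<le> norm ?W * (norm ?D * K)" using K(2)[of ?D ?W] by (simp add: mult_ac)
    also have "\<dots> \<le> norm ?W * (1 / 2)" by (intro mult_left_mono D) auto
    finally show ?case using inv by simp
  qed
  then show ?thesis by blast
qed

lemma matrix_inv_diff:
  fixes X R :: "'a::{euclidean_space,real_normed_field}^'n^'n"
  assumes "invertible X" "invertible R"
  shows "matrix_inv X - matrix_inv R = - (matrix_inv R ** (X - R) ** matrix_inv X)"
  using assms by (simp add: mm_distribs) (simp flip: matrix_mul_assoc)

text \<open>By \<open>matrix_inv_diff\<close> the difference is a vanishing factor times an inverse
  that stays bounded near R.\<close>

lemma tendsto_matrix_inv:
  fixes R :: "'a::{euclidean_space,real_normed_field}^'n^'n"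
  assumes R: "invertible R"
  shows "(matrix_inv \<longlongrightarrow> matrix_inv R) (nhds R)"
proof -
  obtain B where B: "\<forall>\<^sub>F X in nhds R. invertible X \<and> norm (matrix_inv X) \<le> B"
    using matrix_inv_near[OF R] by blast
  have lim: "((\<lambda>X. matrix_inv R ** (X - R)) \<longlongrightarrow> matrix_inv R ** (R - R)) (nhds R)"
    by (intro mm.tendsto tendsto_intros filterlim_ident)
  then have "Zfun (\<lambda>X. matrix_inv R ** (X - R)) (nhds R)"
    by (simp add: mm.zero_right tendsto_Zfun_iff)
  moreover have "Bfun matrix_inv (nhds R)"
    using B by (intro BfunI[of _ B]) (auto elim: eventually_mono)
  ultimately have "Zfun (\<lambda>X. matrix_inv R ** (X - R) ** matrix_inv X) (nhds R)"
    by (rule mm.Zfun_prod_Bfun)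
  then have "Zfun (\<lambda>X. - (matrix_inv R ** (X - R) ** matrix_inv X)) (nhds R)" by (rule Zfun_minus)
  moreover have "\<forall>\<^sub>F X in nhds R. - (matrix_inv R ** (X - R) ** matrix_inv X) = matrix_inv X - matrix_inv R"
    using B by eventually_elim (simp add: matrix_inv_diff R)
  ultimately show ?thesis
    unfolding tendsto_Zfun_iff by (simp add: tendsto_Zfun_iff[of _ 0, simplified, symmetric] cong: tendsto_cong)
qed

text \<open>By \<open>matrix_inv_diff\<close> the remainder is - R^-1 (X - R) (X^-1 - R^-1). Divided
  by |X - R| it tends to zero by continuity of the inverse.\<close>

lemma has_derivative_matrix_inv:
  fixes R :: "'a::{euclidean_space,real_normed_field}^'n^'n"
  assumes R: "invertible R"
  shows "(matrix_inv has_derivative (\<lambda>H. - (matrix_inv R ** H ** matrix_inv R))) (at R)"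
  unfolding has_derivative_iff_norm
proof
  let ?T = "matrix_inv R"
  show "bounded_linear (\<lambda>H. - (?T ** H ** ?T))"
    by (intro bounded_linear_minus mm.bounded_linear_left[THEN bounded_linear_compose] mm.bounded_linear_right)
  obtain K where K: "K > 0" "\<And>(U :: 'a^'n^'n) (V :: 'a^'n^'n). norm (U ** V) \<le> norm U * norm V * K"
    using bounded_bilinear.pos_bounded[OF bounded_bilinear_matrix_mult[where 'a = 'a and 'n = 'n]]
    by auto
  obtain B where B: "\<forall>\<^sub>F X in nhds R. invertible X \<and> norm (matrix_inv X) \<le> B"
    using matrix_inv_near[OF R] by blast
  have "\<forall>\<^sub>F X in at R. X \<noteq> R" by (simp add: eventually_at_filter)
  moreover have "\<forall>\<^sub>F X in at R. invertible X"
    unfolding eventually_at_filter using B by eventually_elim simp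
  ultimately have "\<forall>\<^sub>F X in at R. norm (norm (matrix_inv X - ?T - - (?T ** (X - R) ** ?T)) / norm (X - R))
      \<le> norm ?T * K * K * norm (matrix_inv X - ?T)"
  proof eventually_elim
    case (elim X)
    let ?W = "matrix_inv X"
    have "?W - ?T - - (?T ** (X - R) ** ?T) = - (?T ** (X - R) ** (?W - ?T))"
      by (subst matrix_inv_diff) (use elim R in \<open>auto simp: mm.diff_right\<close>)
    then have "norm (?W - ?T - - (?T ** (X - R) ** ?T)) = norm (?T ** (X - R) ** (?W - ?T))"
      by simp
    also have "\<dots> \<le> norm (?T ** (X - R)) * norm (?W - ?T) * K" by (rule K)
    also have "\<dots> \<le> (norm ?T * norm (X - R) * K) * norm (?W - ?T) * K"
      using K(1) by (intro mult_right_mono K) auto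
    finally show ?case using elim by (simp add: field_simps)
  qed
  moreover have "((\<lambda>X. norm ?T * K * K * norm (matrix_inv X - ?T)) \<longlongrightarrow> 0) (at R)"
    using tendsto_matrix_inv[OF R]
    by (intro tendsto_mult_right_zero tendsto_norm_zero LIM_zero) (rule filterlim_mono[OF _ order_refl at_within_le_nhds])
  ultimately show "((\<lambda>X. norm (matrix_inv X - ?T - - (?T ** (X - R) ** ?T)) / norm (X - R)) \<longlongrightarrow> 0) (at R)"
    by (rule Lim_null_comparison)
qed

lemma has_derivative_minvsqrt:
  assumes R: "rhp (cmat R)" and G: "bounded_linear G" "\<And>D. G (R ** D + D ** R) = D"
  shows "(minvsqrt has_derivative (\<lambda>H. - (matrix_inv R ** G H ** matrix_inv R))) (at (R ** R))"
proof -
  have "(matrix_inv has_derivative (\<lambda>H. - (matrix_inv R ** H ** matrix_inv R))) (at (msqrt (R ** R)))"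
    using has_derivative_matrix_inv[OF rhp_cmat_invertible[OF R]] by (simp add: msqrt_square[OF R])
  from has_derivative_compose[OF has_derivative_msqrt[OF assms] this]
  show ?thesis unfolding minvsqrt_def[abs_def] by simp
qed

subsection \<open>Orders of vanishing\<close>

text \<open>The relation F(h) = O(h^k) for h decreasing to 0. The constant carries no sign
  condition; \<open>ordE\<close> supplies a nonnegative one.\<close>

definition ord :: "nat \<Rightarrow> (real \<Rightarrow> 'a::real_normed_vector) \<Rightarrow> bool" where
  "ord k F \<longleftrightarrow> (\<exists>C. \<forall>\<^sub>F h in at_right 0. norm (F h) \<le> C * h ^ k)"

lemma ordE:
  assumes "ord k F"
  obtains C where "C \<ge> 0" "\<forall>\<^sub>F h in at_right 0. norm (F h) \<le> C * h ^ k"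
proof -
  obtain C where C: "\<forall>\<^sub>F h in at_right 0. norm (F h) \<le> C * h ^ k"
    using assms by (auto simp: ord_def)
  have "\<forall>\<^sub>F h in at_right 0. norm (F h) \<le> \<bar>C\<bar> * h ^ k"
    using C eventually_at_right_less[of 0]
  proof eventually_elim
    case (elim h)
    have "C * h ^ k \<le> \<bar>C\<bar> * h ^ k" using elim by (intro mult_right_mono) auto
    then show ?case using elim by linarith
  qed
  then show thesis using that[of "\<bar>C\<bar>"] by simp
qed

lemma ord_cong:
  assumes "ord k F" "\<forall>\<^sub>F h in at_right 0. F h = G h" shows "ord k G"
proof -
  obtain C where "\<forall>\<^sub>F h in at_right 0. norm (F h) \<le> C * h ^ k" using assms(1) by (auto simp: ord_def)
  with assms(2) have "\<forall>\<^sub>F h in at_right 0. norm (G h) \<le> C * h ^ k" by eventually_elim simp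
  then show ?thesis by (auto simp: ord_def)
qed

lemma ord_add:
  assumes "ord k F" "ord k G" shows "ord k (\<lambda>h. F h + G h)"
proof -
  obtain C D where "\<forall>\<^sub>F h in at_right 0. norm (F h) \<le> C * h ^ k"
    "\<forall>\<^sub>F h in at_right 0. norm (G h) \<le> D * h ^ k" using assms by (auto simp: ord_def)
  then have "\<forall>\<^sub>F h in at_right 0. norm (F h + G h) \<le> (C + D) * h ^ k"
  proof eventually_elim
    case (elim h)
    then show ?case using norm_triangle_ineq[of "F h" "G h"] by (simp add: distrib_right)
  qed
  then show ?thesis by (auto simp: ord_def)
qed

lemma ord_minus: "ord k F \<Longrightarrow> ord k (\<lambda>h. - F h)"
  by (simp add: ord_def)

lemma ord_diff: "ord k F \<Longrightarrow> ord k G \<Longrightarrow> ord k (\<lambda>h. F h - G h)"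
  using ord_add[of k F "\<lambda>h. - G h"] ord_minus[of k G] by simp

lemma ord_linear:
  assumes f: "bounded_linear f" and F: "ord k F" shows "ord k (\<lambda>h. f (F h))"
proof -
  obtain K where K: "K > 0" "\<And>x. norm (f x) \<le> norm x * K"
    using bounded_linear.pos_bounded[OF f] by blast
  obtain C where "\<forall>\<^sub>F h in at_right 0. norm (F h) \<le> C * h ^ k" using F by (auto simp: ord_def)
  then have "\<forall>\<^sub>F h in at_right 0. norm (f (F h)) \<le> (C * K) * h ^ k"
  proof eventually_elim
    case (elim h)
    then have "norm (F h) * K \<le> C * h ^ k * K" using K(1) by (intro mult_right_mono) auto
    then show ?case using K(2)[of "F h"] by (simp add: mult_ac)
  qed
  then show ?thesis by (auto simp: ord_def)
qed

lemma ord_matrix_mult: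
  fixes F G :: "real \<Rightarrow> 'a::{euclidean_space,real_algebra_1}^'n^'n"
  assumes "ord j F" "ord k G" shows "ord (j + k) (\<lambda>h. F h ** G h)"
proof -
  obtain K where K: "K > 0" "\<And>(U :: 'a^'n^'n) (V :: 'a^'n^'n). norm (U ** V) \<le> norm U * norm V * K"
    using bounded_bilinear.pos_bounded[OF bounded_bilinear_matrix_mult[where 'a = 'a and 'n = 'n]]
    by auto
  obtain C D where C: "C \<ge> 0" "\<forall>\<^sub>F h in at_right 0. norm (F h) \<le> C * h ^ j"
    and D: "D \<ge> 0" "\<forall>\<^sub>F h in at_right 0. norm (G h) \<le> D * h ^ k" using assms by (auto elim!: ordE)
  have "\<forall>\<^sub>F h in at_right 0. norm (F h ** G h) \<le> (C * D * K) * h ^ (j + k)"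
    using C(2) D(2) eventually_at_right_less[of 0]
  proof eventually_elim
    case (elim h)
    have "norm (F h ** G h) \<le> norm (F h) * norm (G h) * K" by (rule K)
    also have "\<dots> \<le> (C * h ^ j) * (D * h ^ k) * K"
      using elim K(1) C D by (intro mult_right_mono mult_mono) auto
    finally show ?case by (simp add: power_add mult_ac)
  qed
  then show ?thesis by (auto simp: ord_def)
qed

lemma ord_tendsto: 
  assumes "(F \<longlongrightarrow> L) (at_right 0)" shows "ord 0 F"
proof -
  have "\<forall>\<^sub>F h in at_right 0. norm (F h) < norm L + 1"
    by (rule order_tendstoD(2)[OF tendsto_norm[OF assms]]) simp
  then show ?thesis unfolding ord_def by (intro exI[of _ "norm L + 1"]) (auto elim: eventually_mono)
qed

lemma ord_scaleR: "ord 1 (\<lambda>h. h *\<^sub>R E)"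
  unfolding ord_def
  by (intro exI[of _ "norm E"] eventually_mono[OF eventually_at_right_less[of 0]]) (auto simp: mult.commute)

text \<open>Absorbs the higher-order terms of a quasi-linear equation into its left-hand side.\<close>

lemma ord_absorb:
  fixes F G :: "real \<Rightarrow> 'a::real_normed_vector" and D :: "real \<Rightarrow> 'b::real_normed_vector"
  assumes G: "ord k G" and D: "(D \<longlongrightarrow> 0) (at_right 0)"
    and le: "\<forall>\<^sub>F h in at_right 0. norm (F h - G h) \<le> K * norm (D h) * norm (F h)"
  shows "ord k F"
proof -
  have "((\<lambda>h. K * norm (D h)) \<longlongrightarrow> 0) (at_right 0)"
    by (intro tendsto_mult_right_zero tendsto_norm_zero D)
  then have small: "\<forall>\<^sub>F h in at_right 0. K * norm (D h) < 1 / 2"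
    by (rule order_tendstoD(2)) simp
  obtain C where "\<forall>\<^sub>F h in at_right 0. norm (G h) \<le> C * h ^ k" using G by (auto simp: ord_def)
  with small le have "\<forall>\<^sub>F h in at_right 0. norm (F h) \<le> (2 * C) * h ^ k"
  proof eventually_elim
    case (elim h)
    have "norm (F h) \<le> norm (G h) + norm (F h - G h)" by (rule norm_triangle_sub)
    moreover have "K * norm (D h) * norm (F h) \<le> 1 / 2 * norm (F h)"
      using elim by (intro mult_right_mono) auto
    ultimately show ?case using elim by simp
  qed
  then show ?thesis by (auto simp: ord_def)
qed

lemma ord_mono:
  assumes "ord k F" "j \<le> k" shows "ord j F"
proof -
  obtain C where C: "C \<ge> 0" "\<forall>\<^sub>F h in at_right 0. norm (F h) \<le> C * h ^ k"
    using assms(1) by (rule ordE)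
  have "\<forall>\<^sub>F h in at_right (0::real). h < 1" by (intro order_tendstoD(2)[OF tendsto_ident_at]) simp
  then have "\<forall>\<^sub>F h in at_right 0. norm (F h) \<le> C * h ^ j"
    using C(2) eventually_at_right_less[of 0]
  proof eventually_elim
    case (elim h)
    have "h ^ k \<le> h ^ j" using elim assms(2) by (intro power_decreasing) auto
    then show ?case using elim C(1) mult_left_mono[of "h ^ k" "h ^ j" C] by linarith
  qed
  then show ?thesis by (auto simp: ord_def)
qed

lemma ord_divide:
  assumes "ord 3 (\<lambda>h. F h - h *\<^sub>R L)" shows "ord 2 (\<lambda>h. (1 / h) *\<^sub>R F h - L)"
proof -
  obtain C where "\<forall>\<^sub>F h in at_right 0. norm (F h - h *\<^sub>R L) \<le> C * h ^ 3" using assms by (auto simp: ord_def)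
  then have "\<forall>\<^sub>F h in at_right 0. norm ((1 / h) *\<^sub>R F h - L) \<le> C * h ^ 2"
    using eventually_at_right_less[of 0]
  proof eventually_elim
    case (elim h)
    have "(1 / h) *\<^sub>R F h - L = (1 / h) *\<^sub>R (F h - h *\<^sub>R L)"
      using elim by (simp add: scaleR_right_diff_distrib)
    then have "norm ((1 / h) *\<^sub>R F h - L) = norm (F h - h *\<^sub>R L) / h"
      using elim by simp
    also have "\<dots> \<le> C * h ^ 3 / h" using elim by (intro divide_right_mono) auto
    also have "\<dots> = C * h\<^sup>2" using elim by (simp add: power3_eq_cube power2_eq_square)
    finally show ?case .
  qed
  then show ?thesis by (auto simp: ord_def)
qed

subsection \<open>Complex-step expansion of the square root\<close>

text \<open>The matrix A + ihE in the entrywise form of the initial values in the theorem, so that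
  they fold to it literally.\<close>

definition cstep :: "real^'n^'n \<Rightarrow> real^'n^'n \<Rightarrow> real \<Rightarrow> complex^'n^'n" where
  "cstep A E h = (\<chi> i j. complex_of_real (A$i$j) + \<i> * complex_of_real h * complex_of_real (E$i$j))"

lemma mRe_cstep: "mRe (cstep A E h) = A" and mIm_cstep: "mIm (cstep A E h) = h *\<^sub>R E"
  by (simp_all add: mRe_def mIm_def cstep_def vec_eq_iff)

lemma tendsto_cstep: "(cstep A E \<longlongrightarrow> cmat A) (at_right 0)"
proof (intro vec_tendstoI)
  fix i j
  have "((\<lambda>h. complex_of_real (A$i$j) + \<i> * complex_of_real h * complex_of_real (E$i$j)) \<longlongrightarrow>
      complex_of_real (A$i$j) + \<i> * complex_of_real 0 * complex_of_real (E$i$j)) (at_right 0)"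
    by (intro tendsto_intros)
  then show "((\<lambda>h. cstep A E h $ i $ j) \<longlongrightarrow> cmat A $ i $ j) (at_right 0)"
    by (simp add: cstep_def cmat_def)
qed

text \<open>Applying G to the imaginary and real parts of the squared equation gives, with D = P -
  R, the forms Q = h G(E) - G(D Q + Q D) and D = G(Q^2) - G(D^2). The assumed limit supplies D -> 0,
  which starts the bootstrapping.\<close>

lemma sqrt_expansion:
  fixes R E :: "real^'n^'n" and S :: "real \<Rightarrow> complex^'n^'n"
  assumes lim: "(S \<longlongrightarrow> cmat R) (at_right 0)"
    and sq: "\<forall>\<^sub>F h in at_right 0. S h ** S h = cstep (R ** R) E h"
    and G: "bounded_linear G" "\<And>D. G (R ** D + D ** R) = D"
  shows "ord 2 (\<lambda>h. mRe (S h) - R)" "ord 3 (\<lambda>h. mIm (S h) - h *\<^sub>R G E)"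
proof -
  let ?F = "at_right (0::real)"
  define D where "D h = mRe (S h) - R" for h
  define Q where "Q h = mIm (S h)" for h
  interpret G: bounded_linear G by (rule G(1))
  obtain K where K: "K > 0" "\<And>(U :: real^'n^'n) (V :: real^'n^'n). norm (U ** V) \<le> norm U * norm V * K"
    using bounded_bilinear.pos_bounded[OF bounded_bilinear_matrix_mult[where 'a = real and 'n = 'n]]
    by auto
  obtain L where L: "L > 0" "\<And>U. norm (G U) \<le> norm U * L"
    using G.pos_bounded by blast
  have GK: "norm (G (U ** V)) \<le> K * L * norm U * norm V" for U V :: "real^'n^'n"
  proof -
    have "norm (G (U ** V)) \<le> norm (U ** V) * L" by (rule L)
    also have "\<dots> \<le> norm U * norm V * K * L" using K(2) L(1) by (intro mult_right_mono) auto
    finally show ?thesis by (simp add: mult_ac)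
  qed
  have D0: "(D \<longlongrightarrow> 0) ?F"
    using LIM_zero[OF bounded_linear.tendsto[OF bounded_linear_mRe lim]] by (simp add: D_def[abs_def])
  have Q0: "(Q \<longlongrightarrow> 0) ?F"
    using bounded_linear.tendsto[OF bounded_linear_mIm lim] by (simp add: Q_def[abs_def])
  have eqs: "\<forall>\<^sub>F h in ?F. Q h = h *\<^sub>R G E - (G (D h ** Q h) + G (Q h ** D h))
      \<and> D h = G (Q h ** Q h) - G (D h ** D h)"
    using sq
  proof eventually_elim
    case (elim h)
    have P: "mRe (S h) = R + D h" by (simp add: D_def)
    have "(R + D h) ** Q h + Q h ** (R + D h) = h *\<^sub>R E"
      using arg_cong[OF elim, of mIm] by (simp add: mIm_mult mIm_cstep P Q_def)
    then have "R ** Q h + Q h ** R = h *\<^sub>R E - (D h ** Q h + Q h ** D h)"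
      by (simp add: mm_distribs algebra_simps)
    then have "Q h = h *\<^sub>R G E - (G (D h ** Q h) + G (Q h ** D h))"
      using G(2)[of "Q h"] by (simp add: G.diff G.add G.scaleR)
    moreover have "(R + D h) ** (R + D h) - Q h ** Q h = R ** R"
      using arg_cong[OF elim, of mRe] by (simp add: mRe_mult mRe_cstep P Q_def)
    then have "R ** D h + D h ** R = Q h ** Q h - D h ** D h"
      by (simp add: mm_distribs algebra_simps)
    then have "D h = G (Q h ** Q h) - G (D h ** D h)"
      using G(2)[of "D h"] by (simp add: G.diff)
    ultimately show ?case by blast
  qed
  \<comment> \<open>No rate for D is known yet; D -> 0 suffices, since every correction term is
    bounded by a multiple of |D| |Q|.\<close>
  have Q1: "ord 1 Q"
  proof (rule ord_absorb[OF ord_scaleR[of "G E"] D0])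
    show "\<forall>\<^sub>F h in ?F. norm (Q h - h *\<^sub>R G E) \<le> (2 * K * L) * norm (D h) * norm (Q h)"
      using eqs
    proof eventually_elim
      case (elim h)
      have "h *\<^sub>R G E - Q h = G (D h ** Q h) + G (Q h ** D h)"
        by (subst elim[THEN conjunct1]) simp
      then have "norm (Q h - h *\<^sub>R G E) = norm (G (D h ** Q h) + G (Q h ** D h))"
        by (metis norm_minus_commute)
      also have "\<dots> \<le> norm (G (D h ** Q h)) + norm (G (Q h ** D h))" by (rule norm_triangle_ineq)
      also have "\<dots> \<le> (2 * K * L) * norm (D h) * norm (Q h)"
        using GK[of "D h" "Q h"] GK[of "Q h" "D h"] by (simp add: mult_ac)
      finally show ?case .
    qed
  qed
  have "ord 2 (\<lambda>h. G (Q h ** Q h))"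
    using ord_linear[OF G(1) ord_matrix_mult[OF Q1 Q1]] by (simp add: numeral_2_eq_2)
  then have D2: "ord 2 D"
  proof (rule ord_absorb[OF _ D0])
    show "\<forall>\<^sub>F h in ?F. norm (D h - G (Q h ** Q h)) \<le> (K * L) * norm (D h) * norm (D h)"
      using eqs
    proof eventually_elim
      case (elim h)
      have "norm (D h - G (Q h ** Q h)) = norm (G (D h ** D h))"
        by (subst elim[THEN conjunct2]) simp
      also have "\<dots> \<le> (K * L) * norm (D h) * norm (D h)" by (rule GK)
      finally show ?case .
    qed
  qed
  \<comment> \<open>The orders 2 of D and 1 of Q add up in both products.\<close>
  have "ord 3 (\<lambda>h. - (G (D h ** Q h) + G (Q h ** D h)))"
    using ord_matrix_mult[OF D2 Q1] ord_matrix_mult[OF Q1 D2]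
    by (intro ord_minus ord_add ord_linear[OF G(1)]) (simp_all add: eval_nat_numeral)
  moreover have "\<forall>\<^sub>F h in ?F. - (G (D h ** Q h) + G (Q h ** D h)) = Q h - h *\<^sub>R G E"
    using eqs by eventually_elim (metis add_uminus_conv_diff add_diff_cancel_left')
  ultimately have "ord 3 (\<lambda>h. Q h - h *\<^sub>R G E)" by (rule ord_cong)
  then show "ord 3 (\<lambda>h. mIm (S h) - h *\<^sub>R G E)" by (simp add: Q_def)
  show "ord 2 (\<lambda>h. mRe (S h) - R)" using D2 by (simp add: D_def[abs_def])
qed

text \<open>With T = R^-1 and U + iV the inverse of S h, the parts of S h (U + iV) = 1 give U - T =
  T Q V - T D U and V = - T D V - T Q U. Boundedness of U and V yields first V = O(h), then U - T =
  O(h^2).\<close>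

lemma inverse_expansion:
  fixes R L :: "real^'n^'n" and S :: "real \<Rightarrow> complex^'n^'n"
  assumes R: "rhp (cmat R)" and lim: "(S \<longlongrightarrow> cmat R) (at_right 0)"
    and inv: "\<forall>\<^sub>F h in at_right 0. invertible (S h)"
    and D2: "ord 2 (\<lambda>h. mRe (S h) - R)" and Q3: "ord 3 (\<lambda>h. mIm (S h) - h *\<^sub>R L)"
  shows "ord 2 (\<lambda>h. mRe (matrix_inv (S h)) - matrix_inv R)"
    "ord 3 (\<lambda>h. mIm (matrix_inv (S h)) - h *\<^sub>R (- (matrix_inv R ** L ** matrix_inv R)))"
proof -
  let ?F = "at_right (0::real)"
  define T where "T = matrix_inv R"
  define D where "D h = mRe (S h) - R" for h
  define Q where "Q h = mIm (S h)" for h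
  define U where "U h = mRe (matrix_inv (S h))" for h
  define V where "V h = mIm (matrix_inv (S h))" for h
  have W: "((\<lambda>h. matrix_inv (S h)) \<longlongrightarrow> matrix_inv (cmat R)) ?F"
    by (rule filterlim_compose[OF tendsto_matrix_inv[OF rhp_invertible[OF R]] lim])
  have UV0: "ord 0 U" "ord 0 V"
    unfolding U_def V_def
    by (rule ord_tendsto, rule bounded_linear.tendsto[OF bounded_linear_mRe W],
        rule ord_tendsto, rule bounded_linear.tendsto[OF bounded_linear_mIm W])
  have T0: "ord 0 (\<lambda>h. T)" by (rule ord_tendsto[OF tendsto_const])
  have TR: "T ** R = mat 1" using rhp_cmat_invertible[OF R] by (simp add: T_def)
  have eqs: "\<forall>\<^sub>F h in ?F. U h - T = T ** (Q h ** V h) - T ** (D h ** U h)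
      \<and> V h = - (T ** (D h ** V h)) - T ** (Q h ** U h)"
    using inv
  proof eventually_elim
    case (elim h)
    have P: "mRe (S h) = R + D h" by (simp add: D_def)
    have one: "S h ** matrix_inv (S h) = mat 1" using elim by simp
    have "(R + D h) ** U h - Q h ** V h = mat 1"
      using arg_cong[OF one, of mRe] by (simp add: mRe_mult P U_def V_def Q_def)
    then have "R ** U h = mat 1 + Q h ** V h - D h ** U h"
      by (simp add: mm_distribs algebra_simps)
    then have "T ** (R ** U h) = T ** (mat 1 + Q h ** V h - D h ** U h)" by simp
    then have "U h = T + T ** (Q h ** V h) - T ** (D h ** U h)"
      by (simp add: matrix_mul_assoc TR mm_distribs)
    then have "U h - T = T ** (Q h ** V h) - T ** (D h ** U h)" by (simp add: algebra_simps)
    moreover have "(R + D h) ** V h + Q h ** U h = 0"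
      using arg_cong[OF one, of mIm] by (simp add: mIm_mult P U_def V_def Q_def)
    then have "R ** V h = - (D h ** V h) - Q h ** U h"
      by (simp add: mm_distribs algebra_simps eq_neg_iff_add_eq_0)
    then have "T ** (R ** V h) = T ** (- (D h ** V h) - Q h ** U h)" by simp
    then have "V h = - (T ** (D h ** V h)) - T ** (Q h ** U h)"
      by (simp add: matrix_mul_assoc TR mm_distribs mm.minus_right)
    ultimately show ?case by blast
  qed
  have D2: "ord 2 D" using assms(4) by (simp add: D_def[abs_def])
  have Q3': "ord 3 (\<lambda>h. Q h - h *\<^sub>R L)" using Q3 by (simp add: Q_def)
  have "ord 1 (\<lambda>h. (Q h - h *\<^sub>R L) + h *\<^sub>R L)"
    by (intro ord_add ord_scaleR ord_mono[OF Q3']) simp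
  then have Q1: "ord 1 Q" by simp
  have "ord 1 (\<lambda>h. T ** (Q h ** U h))"
    using ord_matrix_mult[OF T0 ord_matrix_mult[OF Q1 UV0(1)]] by simp
  moreover have "ord 1 (\<lambda>h. T ** (D h ** V h))"
    by (rule ord_mono[OF ord_matrix_mult[OF T0 ord_matrix_mult[OF D2 UV0(2)]]]) simp
  ultimately have "ord 1 (\<lambda>h. - (T ** (D h ** V h)) - T ** (Q h ** U h))"
    by (intro ord_diff ord_minus)
  moreover have "\<forall>\<^sub>F h in ?F. - (T ** (D h ** V h)) - T ** (Q h ** U h) = V h"
    using eqs by eventually_elim simp
  ultimately have V1: "ord 1 V" by (rule ord_cong)
  have "ord 2 (\<lambda>h. T ** (Q h ** V h) - T ** (D h ** U h))"
    using ord_matrix_mult[OF T0 ord_matrix_mult[OF Q1 V1]]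
      ord_matrix_mult[OF T0 ord_matrix_mult[OF D2 UV0(1)]]
    by (intro ord_diff) (simp_all add: numeral_2_eq_2)
  moreover have "\<forall>\<^sub>F h in ?F. T ** (Q h ** V h) - T ** (D h ** U h) = U h - T"
    using eqs by eventually_elim simp
  ultimately have U2: "ord 2 (\<lambda>h. U h - T)" by (rule ord_cong)
  then show "ord 2 (\<lambda>h. mRe (matrix_inv (S h)) - matrix_inv R)" by (simp add: U_def T_def)
  \<comment> \<open>Splitting T Q U around h T L T leaves three errors, of orders 2 + 1, 3 + 0 and 1
    + 2.\<close>
  have "ord 3 (\<lambda>h. - (T ** (D h ** V h)) - T ** ((Q h - h *\<^sub>R L) ** U h)
      - (h *\<^sub>R (T ** L)) ** (U h - T))"
    using ord_matrix_mult[OF T0 ord_matrix_mult[OF D2 V1]]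
      ord_matrix_mult[OF T0 ord_matrix_mult[OF Q3' UV0(1)]]
      ord_matrix_mult[OF ord_scaleR[of "T ** L"] U2]
    by (intro ord_diff ord_minus) (simp_all add: eval_nat_numeral)
  moreover have "\<forall>\<^sub>F h in ?F. - (T ** (D h ** V h)) - T ** ((Q h - h *\<^sub>R L) ** U h)
      - (h *\<^sub>R (T ** L)) ** (U h - T) = V h - h *\<^sub>R (- (T ** L ** T))"
    using eqs
  proof eventually_elim
    case (elim h)
    show ?case
      by (subst elim[THEN conjunct2])
         (simp add: mm_distribs mm.scaleR_left mm.scaleR_right matrix_mul_assoc)
  qed
  ultimately have "ord 3 (\<lambda>h. V h - h *\<^sub>R (- (T ** L ** T)))" by (rule ord_cong)
  then show "ord 3 (\<lambda>h. mIm (matrix_inv (S h)) - h *\<^sub>R (- (matrix_inv R ** L ** matrix_inv R)))"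
    by (simp add: V_def T_def)
qed

lemma complex_step_square_root:
  fixes A E :: "real^'n^'n"
  assumes "\<And>z. Im z = 0 \<Longrightarrow> Re z \<le> 0 \<Longrightarrow> \<not> ceigenvalue (cmat A) z"
  obtains S where "\<forall>\<^sub>F h in at_right 0. rhp (S h) \<and> S h ** S h = cstep A E h"
    "ord 2 (\<lambda>h. mRe (S h) - msqrt A)"
    "ord 2 (\<lambda>h. (1 / h) *\<^sub>R mIm (S h) - frechet_derivative msqrt (at A) E)"
    "ord 2 (\<lambda>h. mRe (matrix_inv (S h)) - minvsqrt A)"
    "ord 2 (\<lambda>h. (1 / h) *\<^sub>R mIm (matrix_inv (S h)) - frechet_derivative minvsqrt (at A) E)"
proof -
  obtain X where X: "X ** X = cmat A" "rhp X" using ex_rhp_sqrt[of "cmat A"] assms by blast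
  define R where "R = mRe X"
  have cR: "cmat R = X" unfolding R_def by (rule rhp_sqrt_real[OF X(2,1)])
  then have R: "rhp (cmat R)" using X by simp
  have "cmat (R ** R) = cmat A" by (simp add: cmat_mult cR X)
  then have RR: "R ** R = A" by (metis mRe_cmat)
  \<comment> \<open>Injectivity over the reals is inherited from the complex Sylvester operator
    through \<open>cmat\<close>.\<close>
  have inj: "D = 0" if "R ** D + D ** R = 0" for D
  proof -
    have "cmat R ** cmat D + cmat D ** cmat R = cmat (R ** D + D ** R)"
      by (simp add: cmat_mult linear_add[OF bounded_linear.linear[OF bounded_linear_cmat]])
    also have "\<dots> = 0" using that by (simp add: cmat_def vec_eq_iff)
    finally have "cmat D = 0" by (rule sylvester_injective[OF R R])
    then show ?thesis by (simp add: cmat_def vec_eq_iff)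
  qed
  obtain G where G: "bounded_linear G" "\<And>D. G (R ** D + D ** R) = D"
    using ex_sylvester_inverse[of R] inj by blast
  define S where "S h = psqrt (cstep A E h)" for h
  have step: "(cstep A E \<longlongrightarrow> cmat R ** cmat R) (at_right 0)"
    using tendsto_cstep[of A E] by (simp add: cR X)
  have sq: "\<forall>\<^sub>F h in at_right 0. rhp (S h) \<and> S h ** S h = cstep A E h"
    unfolding S_def using filterlim_iff[THEN iffD1, OF step, rule_format, OF eventually_psqrt[OF R]] .
  have lim: "(S \<longlongrightarrow> cmat R) (at_right 0)"
    unfolding S_def by (rule filterlim_compose[OF tendsto_psqrt[OF R] step])
  have inv: "\<forall>\<^sub>F h in at_right 0. invertible (S h)"
    using sq by eventually_elim (simp add: rhp_invertible)
  have "\<forall>\<^sub>F h in at_right 0. S h ** S h = cstep (R ** R) E h"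
    using sq by eventually_elim (simp add: RR)
  note exp = sqrt_expansion[OF lim this G]
  note exp_inv = inverse_expansion[OF R lim inv exp]
  have msqrt: "msqrt A = R" using msqrt_square[OF R] by (simp add: RR)
  have d: "frechet_derivative msqrt (at A) = G"
    using frechet_derivative_at[OF has_derivative_msqrt[OF R G]] by (simp add: RR)
  have dinv: "frechet_derivative minvsqrt (at A) = (\<lambda>H. - (matrix_inv R ** G H ** matrix_inv R))"
    using frechet_derivative_at[OF has_derivative_minvsqrt[OF R G]] by (simp add: RR)
  show thesis
    by (rule that[of S])
       (use sq exp(1) exp_inv(1) ord_divide[OF exp(2)] ord_divide[OF exp_inv(2)]
         in \<open>simp_all add: msqrt minvsqrt_def d dinv\<close>)
qed

section \<open>Assembly: explicit thresholds and a common constant\<close>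

lemma eventually_at_right_0_ex:
  assumes "\<forall>\<^sub>F h in at_right (0::real). P h"
  shows "\<exists>h0>0. \<forall>h. 0 < h \<and> h < h0 \<longrightarrow> P h"
  using assms by (auto simp: eventually_at_right_field)

theorem theorem3:
  fixes A E :: "real^'n^'n"
  assumes noneg: "\<And>z. Im z = 0 \<Longrightarrow> Re z \<le> 0 \<Longrightarrow> \<not> ceigenvalue (cmat A) z"
  shows
   "(\<exists>h0>0. \<exists>C. \<forall>h. 0 < h \<and> h < h0 \<longrightarrow>
      (let X0 = (\<chi> i j. complex_of_real (A$i$j) + \<i> * complex_of_real h * complex_of_real (E$i$j))
       in (\<forall>k. invertible (newton_iter X0 k))
        \<and> (\<exists>L. (\<lambda>k. mRe (newton_iter X0 k)) \<longlonglongrightarrow> L \<and> norm (L - msqrt A) \<le> C * h\<^sup>2)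
        \<and> (\<exists>L. (\<lambda>k. mIm ((1/h) *\<^sub>R newton_iter X0 k)) \<longlonglongrightarrow> L
               \<and> norm (L - frechet_derivative msqrt (at A) E) \<le> C * h\<^sup>2)))
  \<and> (\<exists>h0>0. \<exists>C. \<forall>h. 0 < h \<and> h < h0 \<longrightarrow>
      (let Y0 = (\<chi> i j. complex_of_real (A$i$j) + \<i> * complex_of_real h * complex_of_real (E$i$j));
           Y = (\<lambda>k. fst (db_iter Y0 k)); Z = (\<lambda>k. snd (db_iter Y0 k))
       in (\<forall>k. invertible (Y k) \<and> invertible (Z k))
        \<and> (\<exists>L. (\<lambda>k. mRe (Y k)) \<longlonglongrightarrow> L \<and> norm (L - msqrt A) \<le> C * h\<^sup>2)
        \<and> (\<exists>L. (\<lambda>k. mRe (Z k)) \<longlonglongrightarrow> L \<and> norm (L - minvsqrt A) \<le> C * h\<^sup>2)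
        \<and> (\<exists>L. (\<lambda>k. mIm ((1/h) *\<^sub>R Y k)) \<longlonglongrightarrow> L
               \<and> norm (L - frechet_derivative msqrt (at A) E) \<le> C * h\<^sup>2)
        \<and> (\<exists>L. (\<lambda>k. mIm ((1/h) *\<^sub>R Z k)) \<longlonglongrightarrow> L
               \<and> norm (L - frechet_derivative minvsqrt (at A) E) \<le> C * h\<^sup>2)))"
proof -
  obtain S where S: "\<forall>\<^sub>F h in at_right 0. rhp (S h) \<and> S h ** S h = cstep A E h"
    and ords: "ord 2 (\<lambda>h. mRe (S h) - msqrt A)"
    "ord 2 (\<lambda>h. (1 / h) *\<^sub>R mIm (S h) - frechet_derivative msqrt (at A) E)"
    "ord 2 (\<lambda>h. mRe (matrix_inv (S h)) - minvsqrt A)"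
    "ord 2 (\<lambda>h. (1 / h) *\<^sub>R mIm (matrix_inv (S h)) - frechet_derivative minvsqrt (at A) E)"
    using complex_step_square_root[OF noneg, of E] by blast
  obtain C1 where C1: "C1 \<ge> 0" "\<forall>\<^sub>F h in at_right 0. norm (mRe (S h) - msqrt A) \<le> C1 * h\<^sup>2"
    using ords(1) by (rule ordE)
  obtain C2 where C2: "C2 \<ge> 0" "\<forall>\<^sub>F h in at_right 0.
      norm ((1 / h) *\<^sub>R mIm (S h) - frechet_derivative msqrt (at A) E) \<le> C2 * h\<^sup>2"
    using ords(2) by (rule ordE)
  obtain C3 where C3: "C3 \<ge> 0" "\<forall>\<^sub>F h in at_right 0.
      norm (mRe (matrix_inv (S h)) - minvsqrt A) \<le> C3 * h\<^sup>2"
    using ords(3) by (rule ordE)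
  obtain C4 where C4: "C4 \<ge> 0" "\<forall>\<^sub>F h in at_right 0.
      norm ((1 / h) *\<^sub>R mIm (matrix_inv (S h)) - frechet_derivative minvsqrt (at A) E) \<le> C4 * h\<^sup>2"
    using ords(4) by (rule ordE)
  \<comment> \<open>The theorem asks for a single constant in all estimates; nonnegativity of the
    summands makes the sum dominate each of them.\<close>
  define C where "C = C1 + C2 + C3 + C4"
  have C: "x \<le> C * h\<^sup>2"
    if "x \<le> C1 * h\<^sup>2 \<or> x \<le> C2 * h\<^sup>2 \<or> x \<le> C3 * h\<^sup>2 \<or> x \<le> C4 * h\<^sup>2" for x h
  proof -
    have "C1 * h\<^sup>2 \<ge> 0" "C2 * h\<^sup>2 \<ge> 0" "C3 * h\<^sup>2 \<ge> 0" "C4 * h\<^sup>2 \<ge> 0"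
      using C1(1) C2(1) C3(1) C4(1) by simp_all
    then show ?thesis using that unfolding C_def distrib_right by linarith
  qed
  have lim_Re: "(\<lambda>k. mRe (F k)) \<longlonglongrightarrow> mRe L" if "F \<longlonglongrightarrow> L" for F and L :: "complex^'n^'n"
    by (rule bounded_linear.tendsto[OF bounded_linear_mRe that])
  have lim_Im: "(\<lambda>k. mIm (c *\<^sub>R F k)) \<longlonglongrightarrow> c *\<^sub>R mIm L" if "F \<longlonglongrightarrow> L" for F c and L :: "complex^'n^'n"
    using tendsto_scaleR[OF tendsto_const bounded_linear.tendsto[OF bounded_linear_mIm that], of c]
    by (simp add: linear_scale[OF bounded_linear.linear[OF bounded_linear_mIm]])
  have "\<forall>\<^sub>F h in at_right 0. (\<forall>k. invertible (newton_iter (cstep A E h) k))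
      \<and> (\<exists>L. (\<lambda>k. mRe (newton_iter (cstep A E h) k)) \<longlonglongrightarrow> L \<and> norm (L - msqrt A) \<le> C * h\<^sup>2)
      \<and> (\<exists>L. (\<lambda>k. mIm ((1/h) *\<^sub>R newton_iter (cstep A E h) k)) \<longlonglongrightarrow> L
             \<and> norm (L - frechet_derivative msqrt (at A) E) \<le> C * h\<^sup>2)"
    using S C1(2) C2(2)
  proof eventually_elim
    case (elim h)
    note conv = newton_iter_converges[OF conjunct1[OF elim(1)] conjunct2[OF elim(1)]]
    show ?case
      using conv(1) lim_Re[OF conv(2)] lim_Im[OF conv(2), of "1/h"] C elim(2,3) by blast
  qed
  moreover have "\<forall>\<^sub>F h in at_right 0.
      (\<forall>k. invertible (fst (db_iter (cstep A E h) k)) \<and> invertible (snd (db_iter (cstep A E h) k)))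
      \<and> (\<exists>L. (\<lambda>k. mRe (fst (db_iter (cstep A E h) k))) \<longlonglongrightarrow> L \<and> norm (L - msqrt A) \<le> C * h\<^sup>2)
      \<and> (\<exists>L. (\<lambda>k. mRe (snd (db_iter (cstep A E h) k))) \<longlonglongrightarrow> L \<and> norm (L - minvsqrt A) \<le> C * h\<^sup>2)
      \<and> (\<exists>L. (\<lambda>k. mIm ((1/h) *\<^sub>R fst (db_iter (cstep A E h) k))) \<longlonglongrightarrow> L
             \<and> norm (L - frechet_derivative msqrt (at A) E) \<le> C * h\<^sup>2)
      \<and> (\<exists>L. (\<lambda>k. mIm ((1/h) *\<^sub>R snd (db_iter (cstep A E h) k))) \<longlonglongrightarrow> L
             \<and> norm (L - frechet_derivative minvsqrt (at A) E) \<le> C * h\<^sup>2)"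
    using S C1(2) C2(2) C3(2) C4(2)
  proof eventually_elim
    case (elim h)
    note conv = db_iter_converges[OF conjunct1[OF elim(1)] conjunct2[OF elim(1)]]
    show ?case
      using conv(1,2) lim_Re[OF conv(3)] lim_Re[OF conv(4)] lim_Im[OF conv(3), of "1/h"]
        lim_Im[OF conv(4), of "1/h"] C elim(2-5) by blast
  qed
  ultimately show ?thesis
    unfolding Let_def cstep_def[symmetric]
    by (blast dest: eventually_at_right_0_ex)
qed

end
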